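(* Let $\nu$ be a measure on $[0,2\pi]$ in the Szegő class whose Szegő function has an analytic extension up to $|z|>1$. Let $\{\phi_n(z)\}$ be the sequence of monic orthogonal polynomials with respect to $\nu$, let $\{z_j\}_{j=1}^n$ be the zeros of the para-orthogonal polynomials $\omega_n(z)=\phi_n(z)+\tau\phi_n^*(z)$, with $|\tau|=1$, and let $\theta_j\in[0,2\pi]$ be such that $e^{\imath\theta_j}=z_j$ for $j=1,\dots,n$. If $f$ is a continuous function on $[0,2\pi]$ with modulus of continuity $\lambda(f,\delta)=o(\delta^{1/2})$ as $\delta\to0$, then there is a Lagrange interpolation trigonometric polynomial $\tau_{[n/2]}(\theta)$ of degree $\le[n/2]$ such that $\tau_{[n/2]}(\theta_j)=f(\theta_j)$ for $j=1,\dots,n$, and it satisfies $\lim_{n\to\infty}\tau_{[n/2]}(\theta)=f(\theta)$ uniformly on $[0,2\pi]$.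
   Context: $[x]$ denotes the integer part of $x$ and $\imath$ is the imaginary unit. The modulus of continuity of $f$ is $\lambda(f,\delta)=\sup\{|f(s)-f(t)|:s,t\in[0,2\pi],\ |s-t|<\delta\}$. A trigonometric polynomial of degree at most $m$ is a function $a_0+\sum_{k=1}^m(a_k\cos k\theta+b_k\sin k\theta)$ with constant coefficients. A finite positive Borel measure $\nu$ on $[0,2\pi]$ (identified with a measure on the unit circle $\mathbb{T}=\{|z|=1\}$ via $z=e^{\imath\theta}$) is in the Szegő class if $\int_0^{2\pi}\log\nu'(\theta)\,d\theta>-\infty$, where $\nu'$ is the density of its absolutely continuous part with respect to Lebesgue measure. Its Szegő function is taken to be $\Pi(z)=\exp\left(-\frac{1}{4\pi}\int_0^{2\pi}\frac{e^{\imath\theta}+z}{e^{\imath\theta}-z}\log\nu'(\theta)\,d\theta\right)$, $|z|<1$; "analytic extension up to $|z|>1$" means that $\Pi$ extends analytically to a disc $|z|<R$ for some $R>1$. The polynomial $\phi_n$ is the monic polynomial of degree $n$ with $\int_0^{2\pi}\phi_n(e^{\imath\theta})e^{-\imath k\theta}\,d\nu(\theta)=0$ for $0\le k\le n-1$, and $\phi_n^*(z)=z^n\overline{\phi_n(1/\overline{z})}$. The zeros of $\omega_n$ are $n$ distinct points of $\mathbb{T}$. The polynomial $\tau_{[n/2]}(\theta)$ depends on $n$ and is not to be confused with the unimodular constant $\tau$.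
   Formalization: The formal theorem also assumes f(0)=f(2π); without it the claim fails (e.g. f(θ)=θ), since trigonometric polynomials take equal values at 0 and 2π and so do their uniform limits. *)

theory Defs
  imports
    "HOL-Complex_Analysis.Complex_Analysis"
    "HOL-Computational_Algebra.Polynomial"
    "HOL-Library.Landau_Symbols"
begin

text \<open>Lebesgue decomposition \<open>d\<nu> = w d\<theta> + d\<sigma>\<close> with \<open>\<sigma>\<close> carried by a Lebesgue null set.
  The library's \<open>RN_deriv\<close> does not serve here, as it is zero unless \<open>\<nu>\<close> itself has a density.\<close>

definition is_ac_density :: "real measure \<Rightarrow> (real \<Rightarrow> real) \<Rightarrow> bool" where
  "is_ac_density \<nu> w \<longleftrightarrow>
     w \<in> borel_measurable borel \<and> (\<forall>x. 0 \<le> w x) \<and>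
     (\<exists>\<sigma>. sets \<sigma> = sets \<nu> \<and>
          (\<exists>N\<in>null_sets lborel. emeasure \<sigma> (space \<sigma> - N) = 0) \<and>
          (\<forall>A\<in>sets \<nu>. emeasure \<nu> A = (\<integral>\<^sup>+x\<in>A. ennreal (w x) \<partial>lborel) + emeasure \<sigma> A))"

definition ac_density :: "real measure \<Rightarrow> real \<Rightarrow> real" where
  "ac_density \<nu> = (SOME w. is_ac_density \<nu> w)"

lemma ex_ac_density:
  assumes fin: "finite_measure \<nu>" and sets_nu: "sets \<nu> = sets (restrict_space borel {0..2*pi})"
  shows "\<exists>w. is_ac_density \<nu> w"
proof -
  have nn_zero: "(\<And>x. x \<in> space M \<Longrightarrow> u x = 0) \<Longrightarrow> (\<integral>\<^sup>+x. u x \<partial>M) = 0"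
    for M :: "real measure" and u
    by (simp cong: nn_integral_cong)
  define I where "I = {0..2*pi::real}"
  define L where "L = restrict_space lborel I"
  have I[measurable]: "I \<in> sets borel" by (simp add: I_def)
  have sL: "sets L = sets \<nu>"
    unfolding L_def sets_nu I_def by (simp add: sets_restrict_space)
  have spL: "space L = space \<nu>" by (rule sets_eq_imp_space_eq[OF sL])
  have spI: "space \<nu> = I"
    unfolding spL[symmetric] L_def by (simp add: space_restrict_space)
  have finL: "finite_measure L"
    by (rule finite_measureI) (simp add: L_def I_def emeasure_restrict_space space_restrict_space)
  define \<mu> where "\<mu> = measure_of (space \<nu>) (sets \<nu>) (\<lambda>A. emeasure \<nu> A + emeasure L A)"
  have smu[simp, measurable_cong]: "sets \<mu> = sets \<nu>"
    and spmu[simp]: "space \<mu> = space \<nu>"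
    by (auto simp: \<mu>_def)
  have em: "emeasure \<mu> A = emeasure \<nu> A + emeasure L A" if "A \<in> sets \<nu>" for A
    unfolding \<mu>_def
  proof (rule emeasure_measure_of_sigma)
    show "sigma_algebra (space \<nu>) (sets \<nu>)" ..
    show "positive (sets \<nu>) (\<lambda>A. emeasure \<nu> A + emeasure L A)"
      by (simp add: positive_def)
    show "countably_additive (sets \<nu>) (\<lambda>A. emeasure \<nu> A + emeasure L A)"
    proof (rule countably_additiveI)
      fix A :: "nat \<Rightarrow> real set"
      assume "range A \<subseteq> sets \<nu>" "disjoint_family A"
      then show "(\<Sum>i. emeasure \<nu> (A i) + emeasure L (A i)) =
        emeasure \<nu> (\<Union>i. A i) + emeasure L (\<Union>i. A i)"
        using sL by (subst suminf_add[symmetric]) (auto simp: suminf_emeasure)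
    qed
  qed fact
  have finmu: "finite_measure \<mu>"
  proof (rule finite_measureI)
    have "emeasure \<mu> (space \<mu>) = emeasure \<nu> (space \<nu>) + emeasure L (space L)"
      by (simp add: em spL)
    then show "emeasure \<mu> (space \<mu>) \<noteq> \<infinity>"
      using finite_measure.emeasure_finite[OF fin] finite_measure.emeasure_finite[OF finL] by simp
  qed
  interpret mu: finite_measure \<mu> by fact
  have ac1: "absolutely_continuous \<mu> \<nu>" and ac2: "absolutely_continuous \<mu> L"
    by (auto simp: absolutely_continuous_def null_sets_def em sL)
  obtain g where g[measurable]: "g \<in> borel_measurable \<mu>" and dg: "density \<mu> g = \<nu>"
    using mu.Radon_Nikodym[OF ac1] by auto
  obtain h where h[measurable]: "h \<in> borel_measurable \<mu>" and dh: "density \<mu> h = L"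
    using mu.Radon_Nikodym[OF ac2] sL by auto
  have nu_int: "emeasure \<nu> A = (\<integral>\<^sup>+x. g x * indicator A x \<partial>\<mu>)" if "A \<in> sets \<nu>" for A
    using that by (subst dg[symmetric]) (simp add: emeasure_density)
  have L_int: "emeasure L A = (\<integral>\<^sup>+x. h x * indicator A x \<partial>\<mu>)" if "A \<in> sets \<nu>" for A
    using that by (subst dh[symmetric]) (simp add: emeasure_density)
  have "(\<integral>\<^sup>+x. g x \<partial>\<mu>) = emeasure \<nu> (space \<nu>)"
    by (subst nu_int) (auto intro!: nn_integral_cong)
  then have gfin: "AE x in \<mu>. g x \<noteq> \<infinity>"
    using finite_measure.emeasure_finite[OF fin] by (intro nn_integral_PInf_AE) auto
  have "(\<integral>\<^sup>+x. h x \<partial>\<mu>) = emeasure L (space \<nu>)"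
    by (subst L_int) (auto intro!: nn_integral_cong)
  then have hfin: "AE x in \<mu>. h x \<noteq> \<infinity>"
    using finite_measure.emeasure_finite[OF finL] by (intro nn_integral_PInf_AE) auto
  define N where "N = {x \<in> space \<mu>. h x = 0}"
  have N[measurable]: "N \<in> sets \<mu>" unfolding N_def by measurable
  have LN: "emeasure L N = 0"
    using N by (subst L_int) (auto simp: N_def indicator_def intro!: nn_zero)
  define q where "q x = enn2real (g x / h x)" for x
  have q[measurable]: "q \<in> borel_measurable \<mu>" unfolding q_def by measurable
  define w where "w x = indicator I x * q x" for x
  have sub: "A \<subseteq> I" "A \<in> sets borel" if "A \<in> sets \<nu>" for A
  proof -
    show "A \<subseteq> I" using sets.sets_into_space[OF that] spI by simp
    show "A \<in> sets borel" using that I by (auto simp: sets_nu sets_restrict_space I_def)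
  qed
  have "q \<in> borel_measurable (restrict_space borel I)"
    using q by (subst measurable_cong_sets[OF _ refl, of _ \<mu>]) (auto simp: sets_nu I_def)
  then have w[measurable]: "w \<in> borel_measurable borel"
    unfolding w_def by (subst (asm) borel_measurable_restrict_space_iff) auto
  define \<sigma> where "\<sigma> = density \<nu> (indicator N)"
  have dec: "emeasure \<nu> A = (\<integral>\<^sup>+x\<in>A. ennreal (w x) \<partial>lborel) + emeasure \<sigma> A" if A: "A \<in> sets \<nu>" for A
  proof -
    have [measurable]: "A \<in> sets \<mu>" using A by simp
    have "emeasure \<nu> A = emeasure \<nu> (A - N) + emeasure \<nu> (A \<inter> N)"
      using A N by (subst plus_emeasure) (auto intro!: arg_cong[where f="emeasure \<nu>"])
    also have "emeasure \<nu> (A \<inter> N) = emeasure \<sigma> A"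
      using A N by (simp add: \<sigma>_def emeasure_restricted Int_commute)
    also have "emeasure \<nu> (A - N) = (\<integral>\<^sup>+x. g x * indicator (A - N) x \<partial>\<mu>)"
      using A N by (subst nu_int) auto
    also have "\<dots> = (\<integral>\<^sup>+x. h x * (ennreal (q x) * indicator (A - N) x) \<partial>\<mu>)"
    proof (rule nn_integral_cong_AE, use gfin hfin AE_space in eventually_elim)
      fix x assume gh: "g x \<noteq> \<infinity>" "h x \<noteq> \<infinity>" and x: "x \<in> space \<mu>"
      show "g x * indicator (A - N) x = h x * (ennreal (q x) * indicator (A - N) x)"
      proof (cases "x \<in> A - N")
        case True
        then have h0: "h x \<noteq> 0" using x by (auto simp: N_def)
        have "g x / h x \<noteq> \<infinity>" using gh h0 by (simp add: ennreal_divide_eq_top_iff)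
        then have "ennreal (q x) = g x / h x" by (simp add: q_def top.not_eq_extremum)
        then have "h x * ennreal (q x) = g x"
          using gh h0 by (metis ennreal_times_divide infinity_ennreal_def mult.commute mult_divide_eq_ennreal)
        then show ?thesis using True by simp
      qed simp
    qed
    also have "\<dots> = (\<integral>\<^sup>+x. ennreal (q x) * indicator (A - N) x \<partial>density \<mu> h)"
      by (subst nn_integral_density) auto
    also have "\<dots> = (\<integral>\<^sup>+x. ennreal (q x) * indicator (A - N) x \<partial>L)" by (simp add: dh)
    also have "\<dots> = (\<integral>\<^sup>+x. ennreal (q x) * indicator A x \<partial>L)"
    proof (rule nn_integral_cong_AE)
      have "AE x in L. x \<notin> N" using LN N sL by (intro AE_not_in) (auto simp: null_sets_def)
      then show "AE x in L. ennreal (q x) * indicator (A - N) x = ennreal (q x) * indicator A x"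
        by eventually_elim (auto simp: indicator_def)
    qed
    also have "\<dots> = (\<integral>\<^sup>+x\<in>A. ennreal (w x) \<partial>lborel)"
      unfolding L_def using I sub[OF A]
      by (subst nn_integral_restrict_space)
         (auto simp: w_def indicator_def intro!: nn_integral_cong)
    finally show ?thesis .
  qed
  have sg: "emeasure \<sigma> (space \<sigma> - N) = 0"
    using N by (auto simp: \<sigma>_def emeasure_density indicator_def intro!: nn_zero)
  have "emeasure L N = emeasure lborel N"
    unfolding L_def using sub[of N] N by (subst emeasure_restrict_space) auto
  then have Nn: "N \<in> null_sets lborel" using LN sub[of N] N by (auto simp: null_sets_def)
  have "is_ac_density \<nu> w"
    unfolding is_ac_density_def
  proof (intro conjI allI exI[of _ \<sigma>] ballI bexI[of _ N])
    show "0 \<le> w x" for x by (simp add: w_def q_def)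
    show "sets \<sigma> = sets \<nu>" by (simp add: \<sigma>_def)
  qed (use w sg Nn dec in auto)
  then show ?thesis by blast
qed

lemma is_ac_density_ac_density:
  assumes "finite_measure \<nu>" "sets \<nu> = sets (restrict_space borel {0..2*pi})"
  shows "is_ac_density \<nu> (ac_density \<nu>)"
  unfolding ac_density_def using ex_ac_density[OF assms] by (rule someI_ex)

text \<open>Since \<open>ln x \<le> x\<close> and the density is integrable, the integral of \<open>log \<nu>'\<close> always exists in
  \<open>[-\<infinity>, \<infinity>)\<close>, and it exceeds \<open>-\<infinity>\<close> iff \<open>log \<nu>'\<close> is integrable. Positivity almost everywhere is
  spelled out because \<open>ln 0 = 0\<close> in HOL, whereas \<open>log 0 = -\<infinity>\<close> is meant.\<close>

definition szego_class :: "real measure \<Rightarrow> bool" where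
  "szego_class \<nu> \<longleftrightarrow>
     finite_measure \<nu> \<and> sets \<nu> = sets (restrict_space borel {0..2*pi}) \<and>
     (AE \<theta> in lborel. \<theta> \<in> {0..2*pi} \<longrightarrow> 0 < ac_density \<nu> \<theta>) \<and>
     set_integrable lborel {0..2*pi} (\<lambda>\<theta>. ln (ac_density \<nu> \<theta>))"

definition szego_function :: "real measure \<Rightarrow> complex \<Rightarrow> complex" where
  "szego_function \<nu> z =
     exp (- (1 / (4 * of_real pi)) *
          (LINT \<theta>:{0..2*pi}|lborel. (cis \<theta> + z) / (cis \<theta> - z) * of_real (ln (ac_density \<nu> \<theta>))))"

definition szego_function_extends :: "real measure \<Rightarrow> bool" where
  "szego_function_extends \<nu> \<longleftrightarrow>
     (\<exists>R>1. \<exists>F. F holomorphic_on ball 0 R \<and> (\<forall>z\<in>ball 0 1. F z = szego_function \<nu> z))"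

definition monic_orthogonal_polys :: "real measure \<Rightarrow> (nat \<Rightarrow> complex poly) \<Rightarrow> bool" where
  "monic_orthogonal_polys \<nu> \<phi> \<longleftrightarrow>
     (\<forall>n. degree (\<phi> n) = n \<and> lead_coeff (\<phi> n) = 1 \<and>
          (\<forall>k<n. (LINT \<theta>|\<nu>. poly (\<phi> n) (cis \<theta>) * cis (- (real k * \<theta>))) = 0))"

text \<open>The reversal is taken with respect to the actual degree of the polynomial.\<close>

definition star_poly :: "complex poly \<Rightarrow> complex poly" where
  "star_poly p = reflect_poly (map_poly cnj p)"

lemma poly_star_poly:
  assumes "degree p = n" "z \<noteq> 0"
  shows "poly (star_poly p) z = z ^ n * cnj (poly p (1 / cnj z))"
proof -
  have "degree (map_poly cnj p) = n" using assms(1) by (simp add: degree_map_poly)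
  moreover have "poly (map_poly cnj p) (inverse z) = cnj (poly p (cnj (inverse z)))"
    by (simp add: poly_altdef degree_map_poly coeff_map_poly)
  ultimately show ?thesis
    using assms(2) unfolding star_poly_def by (simp add: poly_reflect_poly_nz field_simps)
qed

definition para_orthogonal :: "(nat \<Rightarrow> complex poly) \<Rightarrow> complex \<Rightarrow> nat \<Rightarrow> complex poly" where
  "para_orthogonal \<phi> \<tau> n = \<phi> n + smult \<tau> (star_poly (\<phi> n))"

definition modulus_of_continuity :: "(real \<Rightarrow> 'a::real_normed_vector) \<Rightarrow> real \<Rightarrow> real" where
  "modulus_of_continuity f \<delta> =
     (SUP (s, t) \<in> {(s, t). s \<in> {0..2*pi} \<and> t \<in> {0..2*pi} \<and> \<bar>s - t\<bar> < \<delta>}. norm (f s - f t))"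

definition trig_poly :: "nat \<Rightarrow> (real \<Rightarrow> 'a::real_normed_field) \<Rightarrow> bool" where
  "trig_poly m T \<longleftrightarrow>
     (\<exists>a b. \<forall>\<theta>. T \<theta> = a 0 + (\<Sum>k=1..m. a k * of_real (cos (real k * \<theta>)) + b k * of_real (sin (real k * \<theta>))))"

end

theory Submission
  imports Defs "HOL-Real_Asymp.Real_Asymp"
begin

text \<open>
  On the unit circle \<open>|\<Pi>|\<^sup>2 = 1 / \<nu>'\<close>, so an extension of \<open>\<Pi>\<close> across the circle bounds \<open>\<nu>'\<close> from
  below, and every polynomial \<open>p\<close> of degree less than \<open>n\<close> satisfies
  \<open>|p|\<^sup>2 \<le> n C \<integral> |p|\<^sup>2 d\<nu>\<close> on the circle. Since \<open>\<omega>\<^sub>n\<close> is orthogonal to \<open>z, \<dots>, z\<^bsup>n-1\<^esup>\<close>, the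
  Lagrange basis at its zeros is orthogonal in \<open>L\<^sup>2(\<nu>)\<close>; hence \<open>|p| \<le> \<eta>\<close> at the zeros implies
  \<open>\<integral> |p|\<^sup>2 d\<nu> \<le> \<eta>\<^sup>2 \<nu>(\<bbbT>)\<close>, and the Lebesgue constants are \<open>O(n\<^bsup>1/2\<^esup>)\<close>. A Jackson-type
  approximation with error \<open>o(n\<^bsup>-1/2\<^esup>)\<close> then gives uniform convergence.
\<close>

subsection \<open>Jackson-type approximation\<close>

text \<open>Trigonometric polynomials agree at \<open>0\<close> and \<open>2 * pi\<close>, so
  uniform convergence on \<open>{0..2*pi}\<close> forces \<open>f 0 = f (2*pi)\<close>; distances
  are accordingly measured by \<open>1 - cos (s - t)\<close>.

  The exponent 1/2 has its origin in Cauchy-Schwarz over the \<open>n\<close> coefficients of a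
  polynomial, which costs a factor \<open>sqrt n\<close> in the Lebesgue constant. To beat it by a
  second-moment argument, with a square-root modulus, the approximation kernel needs a second moment
  of order \<open>1 / N^2\<close>.

  The interpolation problem solved is algebraic: \<open>n\<close> nodes determine a polynomial of
  degree less than \<open>n\<close>. With \<open>d = (n - 1) div 2\<close> it is
  \<open>cis (d * t) * f t\<close> that is interpolated, and the factor is removed afterwards. Hence
  the approximants also take the form of an algebraic polynomial close to
  \<open>cis (d * t) * f t\<close>.

  All kernels are sampled at roots of unity, so that their mass and moments are finite sums. The
  lower bound on the density is obtained in tested form, as a bound of the integral of
  \<open>|p|^2\<close> against \<open>\<nu>\<close> from below by the squared coefficients of
  \<open>p\<close>.\<close>

lemma sum_power_cis_mult_cnj:
  assumes "k < N" "l < N"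
  shows "(\<Sum>j<N. cis (2*pi*real j/real N) ^ k * cnj (cis (2*pi*real j/real N)) ^ l)
           = (if k = l then of_nat N else 0)"
proof -
  define q where "q = cis (2*pi*real k/real N) * cnj (cis (2*pi*real l/real N))"
  have N: "N > 0" using assms by simp
  have "cis (2*pi*real j/real N) ^ k * cnj (cis (2*pi*real j/real N)) ^ l = q ^ j" for j
    by (simp add: q_def Complex.DeMoivre power_mult_distrib cis_mult cis_cnj algebra_simps)
  then have eq: "(\<Sum>j<N. cis (2*pi*real j/real N) ^ k * cnj (cis (2*pi*real j/real N)) ^ l) = (\<Sum>j<N. q^j)"
    by simp
  show ?thesis
  proof (cases "k = l")
    case True
    then have "q = 1" by (simp add: q_def cis_mult cis_cnj)
    then show ?thesis using eq True by simp
  next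
    case False
    have "q \<noteq> 1"
    proof
      assume "q = 1"
      then have "cis (2*pi*real k/real N) = cis (2*pi*real l/real N)"
        by (simp add: q_def cis_cnj cis_mult field_simps)
           (metis cis_divide diff_divide_distrib divide_eq_1_iff cis_neq_zero)
      then have "exp (2 * of_real pi * \<i> * of_nat k / of_nat N) = exp (2 * of_real pi * \<i> * of_nat l / of_nat N)"
        by (simp add: cis_conv_exp mult_ac)
      then have "k mod N = l mod N" using complex_root_unity_eq[of N k l] N by simp
      then show False using assms False by simp
    qed
    moreover have "q ^ N = 1"
    proof -
      have "q ^ N = cis (2*pi*real k) * cnj (cis (2*pi*real l))"
        using N by (simp add: q_def power_mult_distrib Complex.DeMoivre flip: complex_cnj_power)
      then show ?thesis by (simp add: cis_multiple_2pi)
    qed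
    ultimately show ?thesis using eq False by (simp add: geometric_sum)
  qed
qed

text \<open>The rotation \<open>u\<close> makes the identity available on every rotated grid. With
  \<open>u = cnj (cis t)\<close> it shows that the mass and the second moment of a kernel centred at
  \<open>t\<close>, sampled on the fixed grid, do not depend on \<open>t\<close>.\<close>

lemma discrete_parseval:
  assumes u: "cmod u = 1"
  shows "(\<Sum>j<N. (cmod (\<Sum>k<N. c k * (u * cis (2*pi*real j/real N)) ^ k))\<^sup>2)
           = real N * (\<Sum>k<N. (cmod (c k))\<^sup>2)"
proof -
  let ?z = "\<lambda>j. cis (2*pi*real j/real N)"
  have "complex_of_real (\<Sum>j<N. (cmod (\<Sum>k<N. c k * (u * ?z j) ^ k))\<^sup>2)
      = (\<Sum>j<N. (\<Sum>k<N. c k * (u * ?z j) ^ k) * (\<Sum>l<N. cnj (c l) * (cnj u * cnj (?z j)) ^ l))"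
    by (simp add: complex_norm_square cnj_sum del: of_real_power)
  also have "\<dots> = (\<Sum>j<N. \<Sum>k<N. \<Sum>l<N. c k * u^k * cnj (c l) * cnj u ^ l * (?z j ^ k * cnj (?z j) ^ l))"
    by (simp add: sum_product power_mult_distrib mult_ac)
  also have "\<dots> = (\<Sum>k<N. \<Sum>l<N. c k * u^k * cnj (c l) * cnj u ^ l * (\<Sum>j<N. ?z j ^ k * cnj (?z j) ^ l))"
    by (subst sum.swap, rule sum.cong, simp, subst sum.swap, simp add: sum_distrib_left)
  also have "\<dots> = (\<Sum>k<N. \<Sum>l<N. if k = l then c k * u^k * cnj (c l) * cnj u ^ l * of_nat N else 0)"
    by (intro sum.cong refl, subst sum_power_cis_mult_cnj) auto
  also have "\<dots> = (\<Sum>k<N. of_nat N * (c k * cnj (c k)) * (u * cnj u)^k)"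
    by (simp add: power_mult_distrib mult_ac)
  also have "u * cnj u = 1" using u by (metis complex_norm_square of_real_1 one_power2)
  also have "(\<Sum>k<N. of_nat N * (c k * cnj (c k)) * 1^k) = complex_of_real (real N * (\<Sum>k<N. (cmod (c k))\<^sup>2))"
    by (simp only: power_one mult_1_right flip: complex_norm_square) (simp add: sum_distrib_left)
  finally show ?thesis using of_real_eq_iff by blast
qed

text \<open>
  The approximation kernel is \<open>|\<Sum> a\<^sub>k w\<^bsup>k\<^esup>|\<^sup>2\<close> with the parabola \<open>a\<^sub>k = (k + 1) (N - 1 - k)\<close>. As
  \<open>1 - cos x = |1 - w|\<^sup>2 / 2\<close> for \<open>w = cis x\<close>, its moment against \<open>1 - cos x\<close> is
    by Parseval the
  energy of the differences \<open>a\<^sub>k - a\<^bsub>k-1\<^esub> = N - 1 - 2 k\<close>.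
\<close>

lemma one_minus_mult_parabola_sum: "(1 - w) * (\<Sum>k<K. of_real ((real k + 1) * (c - real k)) * w ^ k)
   = (\<Sum>k<K. of_real (c - 2 * real k) * w ^ k) - of_real (real K * (c - real K + 1)) * (w::complex) ^ K"
  by (induction K) (auto simp: algebra_simps)

lemma sum_parabola_coeffs: "(\<Sum>k<K. (real k + 1) * (c - real k)) = c * real K * (real K + 1) / 2 - (real K - 1) * real K * (real K + 1) / 3"
  by (induction K) (auto simp: field_simps)

text \<open>Cauchy-Schwarz against the constant sequence bounds \<open>S\<close> from below, so only
  the plain sum \<open>(N - 1) * N * (N + 1) / 6\<close> is evaluated; 36 is the square of this 6.
  The parabola vanishes at \<open>k = -1\<close> and \<open>k = N - 1\<close>, so no jump at the
  ends contributes. Constant coefficients, which give the Fejer kernel, jump at both ends and would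
  leave a quotient of order \<open>1 / N\<close>.\<close>

lemma parabola_difference_bound:
  assumes N: "N \<ge> 2"
  defines "S \<equiv> (\<Sum>k<N. ((real k + 1) * (real N - 1 - real k))\<^sup>2)"
  shows "S > 0" and "(\<Sum>k<N. (real N - 1 - 2 * real k)\<^sup>2) \<le> 36 / (real N)\<^sup>2 * S"
proof -
  have "(\<Sum>k<N. (real k + 1) * (real N - 1 - real k)) = (real N - 1) * real N * (real N + 1) / 6"
    by (subst sum_parabola_coeffs) (simp add: field_simps)
  from this[symmetric] have "((real N - 1) * real N * (real N + 1) / 6)\<^sup>2 \<le> S * real N"
    using Cauchy_Schwarz_ineq_sum[of "\<lambda>k. (real k + 1) * (real N - 1 - real k)" "\<lambda>_. 1" "{..<N}"]
    by (simp add: S_def)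
  moreover have "((real N - 1) * real N * real N / 6)\<^sup>2 \<le> ((real N - 1) * real N * (real N + 1) / 6)\<^sup>2"
    using N by (intro power_mono divide_right_mono mult_left_mono) auto
  ultimately have "(real N - 1)^2 * (real N)^4 \<le> 36 * (S * real N)"
    by (simp add: power2_eq_square power4_eq_xxxx field_simps)
  then have "real N * ((real N - 1)^2 * (real N)^3) \<le> real N * (36 * S)"
    by (simp add: power_eq_if mult_ac)
  then have *: "(real N - 1)^2 * (real N)^3 \<le> 36 * S"
    using N by (subst (asm) mult_le_cancel_left_pos) auto
  have "(real N - 1)^2 * (real N)^3 > 0" using N by simp
  with * show "S > 0" by linarith
  have "(\<Sum>k<N. (real N - 1 - 2 * real k)\<^sup>2) \<le> (\<Sum>k<N. (real N - 1)\<^sup>2)"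
    by (intro sum_mono iffD2[OF abs_le_square_iff[symmetric]] abs_le_square_iff[THEN iffD1]) (use N in auto)
  also have "\<dots> = real N * (real N - 1)\<^sup>2" by simp
  also have "\<dots> \<le> 36 / (real N)\<^sup>2 * S"
    using * N by (simp add: power_eq_if field_simps)
  finally show "(\<Sum>k<N. (real N - 1 - 2 * real k)\<^sup>2) \<le> 36 / (real N)\<^sup>2 * S" .
qed

lemma one_minus_cos: "1 - cos x = (cmod (1 - cis x))\<^sup>2 / 2"
  unfolding cmod_power2 using sin_cos_squared_add[of x] by (simp add: power2_eq_square algebra_simps)

text \<open>The approximant is the average of the samples \<open>f (x j)\<close> with the weights
  \<open>K j / (N * S)\<close>. These are nonnegative and sum to 1 for every \<open>t\<close>, so
  the hypothesis on \<open>f\<close> may be averaged term by term, and 18 is half of 36. The factor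
  \<open>cis ((N - 2) * t)\<close> clears the negative frequencies of the kernel.\<close>

lemma jackson_approx:
  fixes f :: "real \<Rightarrow> real"
  assumes N: "N \<ge> 2" and \<beta>: "\<beta> \<ge> 0"
    and f: "\<And>s t. s \<in> {0..2*pi} \<Longrightarrow> t \<in> {0..2*pi} \<Longrightarrow> \<bar>f s - f t\<bar> \<le> \<alpha> + \<beta> * (1 - cos (s - t))"
  shows "\<exists>Q. degree Q \<le> 2 * (N - 2) \<and>
    (\<forall>t\<in>{0..2*pi}. cmod (poly Q (cis t) - cis (real (N - 2) * t) * of_real (f t)) \<le> \<alpha> + 18 * \<beta> / (real N)\<^sup>2)"
proof -
  define a where "a k = (real k + 1) * (real N - 1 - real k)" for k
  define b where "b k = real N - 1 - 2 * real k" for k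
  define S where "S = (\<Sum>k<N. (a k)\<^sup>2)"
  define x where "x j = 2*pi*real j/real N" for j
  have S: "S > 0" "(\<Sum>k<N. (b k)\<^sup>2) \<le> 36 / (real N)\<^sup>2 * S"
    using parabola_difference_bound[OF N] by (auto simp: S_def a_def b_def)
  have x: "x j \<in> {0..2*pi}" if "j < N" for j
    using that by (auto simp: x_def field_simps)
  \<comment> \<open>The last coefficient vanishes, so \<open>A\<close> has degree at most
    \<open>N - 2\<close> although Parseval is applied with \<open>N\<close> coefficients.\<close>
  have aN: "a (N - Suc 0) = 0" using N by (simp add: a_def)
  define A where "A w = (\<Sum>k<N. of_real (a k) * w ^ k)" for w :: complex
  have A': "A w = (\<Sum>k\<le>N-2. of_real (a k) * w ^ k)" for w
  proof -
    have "{..<N} = insert (N-1) {..N-2}" "N - 1 \<notin> {..N-2}" using N by auto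
    then show ?thesis by (simp add: A_def aN)
  qed
  \<comment> \<open>At \<open>cis t\<close> the polynomial \<open>V j\<close> is the conjugate of
    \<open>A (cis (x j - t))\<close>, and \<open>U j\<close> is \<open>A (cis (x j - t))\<close>
    times \<open>cis t ^ (N - 2)\<close>; the product is the kernel in polynomial form.\<close>
  define U where "U j = (\<Sum>k\<le>N-2. monom (of_real (a k) * cis (x j) ^ k) (N - 2 - k))" for j
  define V where "V j = (\<Sum>k\<le>N-2. monom (of_real (a k) * cnj (cis (x j)) ^ k) k)" for j
  define Q where "Q = (\<Sum>j<N. smult (of_real (f (x j) / (real N * S))) (U j * V j))"
  have "degree (U j) \<le> N - 2" "degree (V j) \<le> N - 2" for j
    unfolding U_def V_def by (intro degree_sum_le; force intro: order_trans[OF degree_monom_le])+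
  then have "degree (U j * V j) \<le> 2 * (N - 2)" for j
    by (intro order_trans[OF degree_mult_le]) (metis add_mono mult_2)
  then have "degree Q \<le> 2 * (N - 2)"
    unfolding Q_def by (intro degree_sum_le) (auto intro: order_trans[OF degree_smult_le])
  moreover have "cmod (poly Q (cis t) - cis (real (N - 2) * t) * of_real (f t)) \<le> \<alpha> + 18 * \<beta> / (real N)\<^sup>2"
    if t: "t \<in> {0..2*pi}" for t
  proof -
    define K where "K j = (cmod (A (cis (x j - t))))\<^sup>2" for j
    have w: "cis (x j - t) = cnj (cis t) * cis (2*pi*real j/real N)" for j
      by (simp add: x_def cis_cnj cis_mult)
    have K: "(\<Sum>j<N. K j) = real N * S"
      using discrete_parseval[of "cnj (cis t)" "\<lambda>k. of_real (a k)" N]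
      by (simp add: K_def A_def S_def w)
    have D: "(1 - cos (t - x j)) * K j = (cmod (\<Sum>k<N. of_real (b k) * cis (x j - t) ^ k))\<^sup>2 / 2" for j
    proof -
      have "1 - cos (t - x j) = 1 - cos (x j - t)" by (metis cos_minus minus_diff_eq)
      moreover have "(1 - cis (x j - t)) * A (cis (x j - t)) = (\<Sum>k<N. of_real (b k) * cis (x j - t) ^ k)"
        using one_minus_mult_parabola_sum[of "cis (x j - t)" "real N - 1" N]
          by (simp add: A_def a_def b_def)
      from this[symmetric] show ?thesis using calculation
        by (simp add: K_def one_minus_cos norm_mult power_mult_distrib)
    qed
    have KD: "(\<Sum>j<N. (1 - cos (t - x j)) * K j) \<le> 18 / (real N)\<^sup>2 * (real N * S)"
    proof -
      have "(\<Sum>j<N. (1 - cos (t - x j)) * K j) = real N * (\<Sum>k<N. (b k)\<^sup>2) / 2"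
        using discrete_parseval[of "cnj (cis t)" "\<lambda>k. of_real (b k)" N]
        by (simp add: D w flip: sum_divide_distrib)
      also have "\<dots> \<le> real N * (36 / (real N)\<^sup>2 * S) / 2"
        using S(2) by (intro divide_right_mono mult_left_mono) auto
      finally show ?thesis by (simp add: mult_ac)
    qed
    have UV: "poly (U j * V j) (cis t) = cis (real (N - 2) * t) * of_real (K j)" for j
    proof -
      have "poly (U j) (cis t) = (\<Sum>k\<le>N-2. cis t ^ (N - 2) * (of_real (a k) * cis (x j - t) ^ k))"
      proof (unfold U_def poly_sum, rule sum.cong)
        fix k assume k: "k \<in> {..N-2}"
        have "cis t ^ (N - 2) = cis t ^ (N - 2 - k) * cis t ^ k"
          using k by (metis atMost_iff le_add_diff_inverse2 power_add)
        moreover have "cis t ^ k * cis (x j - t) ^ k = cis (x j) ^ k"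
          by (simp add: cis_mult flip: power_mult_distrib)
        ultimately show "poly (monom (of_real (a k) * cis (x j) ^ k) (N - 2 - k)) (cis t)
          = cis t ^ (N - 2) * (of_real (a k) * cis (x j - t) ^ k)"
          by (simp add: poly_monom)
      qed simp
      then have 1: "poly (U j) (cis t) = cis (real (N - 2) * t) * A (cis (x j - t))"
        by (simp only: A' sum_distrib_left Complex.DeMoivre)
      have 2: "poly (V j) (cis t) = cnj (A (cis (x j - t)))"
        by (simp add: V_def poly_sum poly_monom A' cis_cnj cis_mult mult.assoc flip: power_mult_distrib)
      show ?thesis unfolding poly_mult 1 2 K_def complex_norm_square by simp
    qed
    have NS: "real N * S > 0" using N S by simp
    have "poly Q (cis t) - cis (real (N - 2) * t) * of_real (f t)
      = cis (real (N - 2) * t) * of_real ((\<Sum>j<N. f (x j) * K j) / (real N * S) - f t)"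
      by (simp add: Q_def poly_sum UV[unfolded poly_mult] algebra_simps sum_distrib_left sum_divide_distrib)
    also have "(\<Sum>j<N. f (x j) * K j) / (real N * S) - f t = (\<Sum>j<N. (f (x j) - f t) * K j) / (real N * S)"
      unfolding left_diff_distrib sum_subtractf sum_distrib_left[symmetric] K diff_divide_distrib
        nonzero_mult_div_cancel_right[OF less_imp_neq[OF NS, symmetric]] ..
    finally have "cmod (poly Q (cis t) - cis (real (N - 2) * t) * of_real (f t))
        = \<bar>(\<Sum>j<N. (f (x j) - f t) * K j) / (real N * S)\<bar>"
      by (simp only: norm_mult norm_cis norm_of_real mult_1)
    also have "\<dots> = \<bar>\<Sum>j<N. (f (x j) - f t) * K j\<bar> / (real N * S)"
      using NS by (simp only: abs_divide abs_of_pos)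
    also have "\<dots> \<le> (\<Sum>j<N. (\<alpha> + \<beta> * (1 - cos (t - x j))) * K j) / (real N * S)"
    proof (intro divide_right_mono order_trans[OF sum_abs] sum_mono)
      fix j assume j: "j \<in> {..<N}"
      have "\<bar>f (x j) - f t\<bar> \<le> \<alpha> + \<beta> * (1 - cos (t - x j))"
        using f[OF t x[of j]] j by (simp add: abs_minus_commute)
      then show "\<bar>(f (x j) - f t) * K j\<bar> \<le> (\<alpha> + \<beta> * (1 - cos (t - x j))) * K j"
        by (simp add: abs_mult K_def mult_right_mono)
    qed (use NS in auto)
    also have "(\<Sum>j<N. (\<alpha> + \<beta> * (1 - cos (t - x j))) * K j)
      = \<alpha> * (real N * S) + \<beta> * (\<Sum>j<N. (1 - cos (t - x j)) * K j)"
      unfolding K[symmetric] by (simp only: distrib_right sum.distrib sum_distrib_left mult.assoc)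
    also have "\<dots> / (real N * S) \<le> (\<alpha> * (real N * S) + \<beta> * (18 / (real N)\<^sup>2 * (real N * S))) / (real N * S)"
      using KD NS \<beta> by (intro divide_right_mono add_left_mono mult_left_mono) auto
    also have "\<dots> = (\<alpha> + 18 * \<beta> / (real N)\<^sup>2) * (real N * S) / (real N * S)"
      by (simp add: algebra_simps)
    also have "\<dots> = \<alpha> + 18 * \<beta> / (real N)\<^sup>2"
      by (rule nonzero_mult_div_cancel_right[OF less_imp_neq[OF NS, symmetric]])
    finally show ?thesis .
  qed
  ultimately show ?thesis by blast
qed

section \<open>From the modulus of continuity to an estimate of Korovkin type\<close>

lemma norm_diff_le_modulus_of_continuity:
  assumes "continuous_on {0..2*pi} f" "s \<in> {0..2*pi}" "t \<in> {0..2*pi}" "\<bar>s - t\<bar> < \<delta>"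
  shows "norm (f s - f t) \<le> modulus_of_continuity f \<delta>"
proof -
  let ?P = "{(s, t). s \<in> {0..2*pi} \<and> t \<in> {0..2*pi} \<and> \<bar>s - t\<bar> < \<delta>}"
  have "bounded (f ` {0..2*pi})"
    using assms(1) by (intro compact_imp_bounded compact_continuous_image) auto
  then obtain M where M: "\<And>t. t \<in> {0..2*pi} \<Longrightarrow> norm (f t) \<le> M"
    unfolding bounded_iff by blast
  have "bdd_above ((\<lambda>(s, t). norm (f s - f t)) ` ?P)"
  proof (rule bdd_aboveI2[of _ _ "M + M"])
    fix x assume "x \<in> ?P"
    then obtain s t where x: "x = (s, t)" "norm (f s) \<le> M" "norm (f t) \<le> M" using M by blast
    then show "(case x of (s, t) \<Rightarrow> norm (f s - f t)) \<le> M + M"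
      using norm_triangle_ineq4[of "f s" "f t"] by simp
  qed
  then have "(case (s, t) of (s, t) \<Rightarrow> norm (f s - f t)) \<le> modulus_of_continuity f \<delta>"
    unfolding modulus_of_continuity_def using assms by (intro cSUP_upper) auto
  then show ?thesis by simp
qed

text \<open>This is \<open>y \<le> 1 + y ^ 4\<close> for \<open>y = sqrt (N * x)\<close>. It trades
  a square root for a quadratic term at scale \<open>1 / N\<close>, which is the quantity that the
  kernel controls.\<close>

lemma sqrt_le_scaled:
  assumes "x \<ge> 0" "N > 0"
  shows "sqrt x \<le> (1 + (real N)\<^sup>2 * x\<^sup>2) / sqrt (real N)"
proof -
  define y where "y = sqrt (real N * x)"
  have y: "y \<ge> 0" "y ^ 2 = real N * x" using assms by (auto simp: y_def)
  have "y \<le> 1 + y ^ 4"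
  proof (cases "y \<le> 1")
    case False
    then have "y \<le> y ^ 4" using power_increasing[of 1 4 y] by simp
    then show ?thesis by simp
  qed (simp add: add_increasing2)
  also have "y ^ 4 = (real N)\<^sup>2 * x\<^sup>2"
    using y(2) by (metis (no_types, lifting) mult_2 numeral_Bit0 power_add power_mult_distrib power2_eq_square)
  finally show ?thesis using assms by (simp add: y_def real_sqrt_mult field_simps)
qed

text \<open>Pairs that are close modulo \<open>2 * pi\<close> are handled by the little-o
  hypothesis, all others by boundedness of \<open>f\<close>, since \<open>1 - cos\<close> stays away
  from 0 there. The constant \<open>A\<close> does not depend on \<open>N\<close>, so after
  multiplication by a second moment of order \<open>1 / N^2\<close> it is negligible against
  \<open>1 / sqrt N\<close>.\<close>

lemma modulus_korovkin_bound:
  fixes f :: "real \<Rightarrow> 'a::real_normed_vector"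
  assumes f: "continuous_on {0..2*pi} f" "f 0 = f (2*pi)"
    and o: "modulus_of_continuity f \<in> o[at_right 0](\<lambda>\<delta>. \<delta> powr (1/2))"
    and \<epsilon>: "\<epsilon> > 0"
  shows "\<exists>A\<ge>0. \<forall>N>0. \<forall>s\<in>{0..2*pi}. \<forall>t\<in>{0..2*pi}. norm (f s - f t)
    \<le> \<epsilon> / sqrt (real N) + (\<epsilon> * (real N)\<^sup>2 / sqrt (real N) + A) * (1 - cos (s - t))"
proof -
  let ?I = "{0..2*pi}"
  have "bounded (f ` ?I)"
    using f(1) by (intro compact_imp_bounded compact_continuous_image) auto
  then obtain M where M: "M > 0" "\<And>t. t \<in> ?I \<Longrightarrow> norm (f t) \<le> M"
    unfolding bounded_pos by blast
  have "\<forall>\<^sub>F x in at_right 0. norm (modulus_of_continuity f x) \<le> \<epsilon> / 20 * norm (x powr (1/2))"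
    using \<epsilon> by (intro landau_o.smallD[OF o]) simp
  moreover have "\<forall>\<^sub>F x::real in at_right 0. x\<^sup>2 \<le> 5 * (1 - cos x)" by real_asymp
  ultimately have "\<forall>\<^sub>F x in at_right 0. norm (modulus_of_continuity f x) \<le> \<epsilon> / 20 * norm (x powr (1/2)) \<and> x\<^sup>2 \<le> 5 * (1 - cos x)"
    by (rule eventually_conj)
  then obtain b where b: "b > 0" "\<And>x. 0 < x \<Longrightarrow> x < b \<Longrightarrow> modulus_of_continuity f x \<le> \<epsilon> / 20 * sqrt x"
    "\<And>x. 0 < x \<Longrightarrow> x < b \<Longrightarrow> x\<^sup>2 \<le> 5 * (1 - cos x)"
    unfolding eventually_at_right_field by (force simp: powr_half_sqrt)
  define \<delta> where "\<delta> = min (b / 2) pi"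
  have \<delta>: "0 < \<delta>" "\<delta> \<le> pi" "2 * \<delta> \<le> b"
    using b(1) by (auto simp: \<delta>_def)
  have loc: "norm (f s - f t) \<le> \<epsilon> / 10 * sqrt \<bar>s - t\<bar>"
    if "s \<in> ?I" "t \<in> ?I" "\<bar>s - t\<bar> < \<delta>" for s t
  proof (cases "s = t")
    case False
    \<comment> \<open>The modulus is a supremum over strictly smaller distances, so it is taken at
      twice the distance; \<open>sqrt 2 < 2\<close> then turns \<open>\<epsilon> / 20\<close> into
      \<open>\<epsilon> / 10\<close>. The detour through an endpoint below doubles this to
      \<open>\<epsilon> / 5\<close>, and the 5 is consumed by
      \<open>x\<^sup>2 \<le> 5 * (1 - cos x)\<close>, which holds near 0 because the quotient tends
      to 2.\<close>
    then have "norm (f s - f t) \<le> modulus_of_continuity f (2 * \<bar>s - t\<bar>)"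
      using that by (intro norm_diff_le_modulus_of_continuity f) auto
    also have "\<dots> \<le> \<epsilon> / 20 * sqrt (2 * \<bar>s - t\<bar>)"
      using False that \<delta> by (intro b) auto
    also have "\<dots> \<le> \<epsilon> / 20 * (2 * sqrt \<bar>s - t\<bar>)"
      using \<epsilon> sqrt2_less_2
        by (intro mult_left_mono) (auto simp: real_sqrt_mult intro!: mult_right_mono)
    finally show ?thesis by simp
  qed simp
  have scaled: "\<epsilon> / 5 * sqrt x \<le> \<epsilon> / sqrt (real N) + (\<epsilon> * (real N)\<^sup>2 / sqrt (real N)) * (1 - cos x)"
    if "0 \<le> x" "x < \<delta>" "N > 0" for x N
  proof -
    have "x\<^sup>2 \<le> 5 * (1 - cos x)" using that \<delta> b(3)[of x] by (cases "x = 0") auto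
    then have "1 + (real N)\<^sup>2 * x\<^sup>2 \<le> 5 * (1 + (real N)\<^sup>2 * (1 - cos x))"
      using mult_left_mono[of "x\<^sup>2" "5 * (1 - cos x)" "(real N)\<^sup>2"] by (simp add: algebra_simps)
    then have "(1 + (real N)\<^sup>2 * x\<^sup>2) / sqrt (real N) \<le> 5 * (1 + (real N)\<^sup>2 * (1 - cos x)) / sqrt (real N)"
      by (rule divide_right_mono) simp
    then have "sqrt x \<le> 5 * (1 + (real N)\<^sup>2 * (1 - cos x)) / sqrt (real N)"
      using sqrt_le_scaled[OF that(1,3)] by (rule order_trans[rotated])
    then have "\<epsilon> / 5 * sqrt x \<le> \<epsilon> / 5 * (5 * (1 + (real N)\<^sup>2 * (1 - cos x)) / sqrt (real N))"
      using \<epsilon> by (intro mult_left_mono) auto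
    also have "\<dots> = \<epsilon> / sqrt (real N) + (\<epsilon> * (real N)\<^sup>2 / sqrt (real N)) * (1 - cos x)"
      by (simp add: algebra_simps add_divide_distrib diff_divide_distrib)
    finally show ?thesis .
  qed
  have cos\<delta>: "cos \<delta> < 1" using \<delta> cos_monotone_0_pi[of 0 \<delta>] by simp
  define A where "A = 2 * M / (1 - cos \<delta>)"
  have A: "A \<ge> 0" using M cos\<delta> by (simp add: A_def)
  have main: "norm (f s - f t) \<le> \<epsilon> / sqrt (real N) + (\<epsilon> * (real N)\<^sup>2 / sqrt (real N) + A) * (1 - cos (t - s))"
    if st: "s \<in> ?I" "t \<in> ?I" "s \<le> t" and N: "N > 0" for s t N
  proof -
    define x where "x = t - s"
    have x: "0 \<le> x" "x \<le> 2 * pi" using st by (auto simp: x_def)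
    have c: "0 \<le> A * (1 - cos x)" using A by simp
    have e: "0 \<le> \<epsilon> / sqrt (real N) + (\<epsilon> * (real N)\<^sup>2 / sqrt (real N)) * (1 - cos x)"
      using \<epsilon> by (intro add_nonneg_nonneg mult_nonneg_nonneg) auto
    consider "x < \<delta>" | "2 * pi - x < \<delta>" | "\<delta> \<le> x" "x \<le> 2 * pi - \<delta>"
      by linarith
    then have "norm (f s - f t) \<le> \<epsilon> / sqrt (real N) + (\<epsilon> * (real N)\<^sup>2 / sqrt (real N)) * (1 - cos x) + A * (1 - cos x)"
    proof cases
      case 1
      have "norm (f s - f t) \<le> \<epsilon> / 10 * sqrt x"
        using loc[OF st(1,2)] 1 st(3) by (simp add: x_def)
      also have "\<dots> \<le> \<epsilon> / 5 * sqrt x" using \<epsilon> x by (intro mult_right_mono) auto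
      finally show ?thesis using scaled[OF x(1) 1 N] c by linarith
    next
      case 2
      \<comment> \<open>Now \<open>s\<close> is near \<open>0\<close> and \<open>t\<close> near
        \<open>2 * pi\<close>; the short way between them passes through the identified
        endpoints.\<close>
      have "norm (f s - f t) \<le> norm (f s - f 0) + norm (f (2*pi) - f t)"
        using norm_triangle_ineq[of "f s - f 0" "f (2*pi) - f t"] f(2) by simp
      also have "\<dots> \<le> \<epsilon> / 10 * sqrt s + \<epsilon> / 10 * sqrt (2*pi - t)"
        using loc[of s 0] loc[of "2*pi" t] 2 st by (intro add_mono) (auto simp: x_def)
      also have "\<dots> \<le> \<epsilon> / 10 * sqrt (2*pi - x) + \<epsilon> / 10 * sqrt (2*pi - x)"
        using st \<epsilon> by (intro add_mono mult_left_mono) (auto simp: x_def)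
      also have "\<dots> = \<epsilon> / 5 * sqrt (2*pi - x)" by simp
      finally have "norm (f s - f t) \<le> \<epsilon> / sqrt (real N) + (\<epsilon> * (real N)\<^sup>2 / sqrt (real N)) * (1 - cos (2*pi - x))"
        using scaled[of "2*pi - x" N] 2 x N by linarith
      then show ?thesis using c by simp
    next
      case 3
      have "cos x \<le> cos \<delta>"
      proof (cases "x \<le> pi")
        case True
        then show ?thesis using 3 \<delta> by (intro cos_monotone_0_pi_le) auto
      next
        case False
        then have "cos (2*pi - x) \<le> cos \<delta>" using 3 \<delta> by (intro cos_monotone_0_pi_le) auto
        then show ?thesis by simp
      qed
      then have "A * (1 - cos \<delta>) \<le> A * (1 - cos x)" using A by (intro mult_left_mono) auto
      moreover have "A * (1 - cos \<delta>) = 2 * M" using cos\<delta> by (simp add: A_def)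
      moreover have "norm (f s - f t) \<le> M + M"
        using M(2) st by (intro order_trans[OF norm_triangle_ineq4] add_mono) auto
      ultimately show ?thesis using e by linarith
    qed
    then show ?thesis by (simp add: x_def algebra_simps)
  qed
  have "norm (f s - f t) \<le> \<epsilon> / sqrt (real N) + (\<epsilon> * (real N)\<^sup>2 / sqrt (real N) + A) * (1 - cos (s - t))"
    if "s \<in> ?I" "t \<in> ?I" "N > 0" for s t N
  proof (cases "s \<le> t")
    case True
    have "cos (s - t) = cos (t - s)" by (metis cos_minus minus_diff_eq)
    then show ?thesis using main[OF that(1,2) True that(3)] by simp
  next
    case False
    then show ?thesis using main[of t s N] that by (simp add: norm_minus_commute)
  qed
  then show ?thesis using A by blast
qed

subsection \<open>Lower bound for the measure\<close>

lemma sum_inverse_one_minus_roots: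
  assumes N: "N > 0" and x: "cmod x < 1"
  shows "(\<Sum>j<N. 1 / (1 - x * cis (2*pi*real j/real N))) = of_nat N / (1 - x ^ N)"
proof -
  let ?z = "\<lambda>j. cis (2*pi*real j/real N)"
  have x1: "x ^ N \<noteq> 1"
    using power_strict_mono[OF x norm_ge_zero N] by (auto simp flip: norm_power)
  have "(\<Sum>j<N. (1 - x ^ N) / (1 - x * ?z j)) = (\<Sum>j<N. \<Sum>k<N. x ^ k * (?z j ^ k * cnj (?z j) ^ 0))"
  proof (rule sum.cong)
    fix j assume j: "j \<in> {..<N}"
    have z: "?z j ^ N = 1" using N by (simp add: Complex.DeMoivre cis_multiple_2pi)
    have "cmod (x * ?z j) < 1" using x by (simp add: norm_mult)
    then have ne: "x * ?z j \<noteq> 1" by auto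
    \<comment> \<open>Since \<open>?z j ^ N = 1\<close>, the number \<open>1 - x ^ N\<close> is also
      \<open>1 - (x * ?z j) ^ N\<close>, and the quotient is a finite geometric sum.\<close>
    have "(1 - x * ?z j) * (\<Sum>k<N. (x * ?z j) ^ k) = 1 - x ^ N"
      unfolding one_diff_power_eq[symmetric] by (simp add: power_mult_distrib z)
    then show "(1 - x ^ N) / (1 - x * ?z j) = (\<Sum>k<N. x ^ k * (?z j ^ k * cnj (?z j) ^ 0))"
      using ne by (simp add: field_simps power_mult_distrib)
  qed simp
  also have "\<dots> = (\<Sum>k<N. x ^ k * (\<Sum>j<N. ?z j ^ k * cnj (?z j) ^ 0))"
    by (subst sum.swap) (simp add: sum_distrib_left)
  also have "\<dots> = (\<Sum>k<N. if k = 0 then of_nat N else 0)"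
    using N by (intro sum.cong refl, subst sum_power_cis_mult_cnj) auto
  also have "\<dots> = of_nat N" using N by simp
  finally have "(1 - x ^ N) * (\<Sum>j<N. 1 / (1 - x * ?z j)) = of_nat N"
    by (simp add: sum_distrib_left)
  then show ?thesis using x1 by (simp add: field_simps)
qed

lemma Re_herglotz: "Re ((1 + x) / (1 - x)) = (1 - (cmod x)\<^sup>2) / (cmod (1 - x))\<^sup>2"
  unfolding cmod_power2 by (simp add: Re_divide power2_eq_square algebra_simps)

lemma herglotz_unit:
  assumes "cmod \<zeta> = 1"
  shows "(\<zeta> + z) / (\<zeta> - z) = (1 + z * cnj \<zeta>) / (1 - z * cnj \<zeta>)"
proof -
  have "\<zeta> * cnj \<zeta> = 1" using assms by (metis complex_norm_square of_real_1 one_power2)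
  then have "\<zeta> + z = \<zeta> * (1 + z * cnj \<zeta>)" "\<zeta> - z = \<zeta> * (1 - z * cnj \<zeta>)"
    by (simp_all add: algebra_simps)
  moreover have "\<zeta> \<noteq> 0" using assms by auto
  ultimately show ?thesis by simp
qed

lemma Re_mult_of_nat: "Re (q * of_nat n) = Re q * real n"
  by simp

text \<open>
  Discretising the Poisson integral of \<open>h\<close> at roots of unity makes the exchange with the integral
  against \<open>log \<nu>'\<close> a finite sum, so no Fubini argument is needed.
\<close>

lemma poisson_approx:
  fixes h :: "complex \<Rightarrow> real"
  assumes h: "continuous_on (sphere 0 1) h" and \<delta>: "\<delta> > 0"
  shows "\<exists>r N0. 0 < r \<and> r < 1 \<and> (\<forall>N\<ge>N0. \<forall>\<zeta>. cmod \<zeta> = 1 \<longrightarrow>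
     \<bar>(\<Sum>j<N. h (cis (2*pi*real j/real N)) *
        Re ((\<zeta> + of_real r * cis (2*pi*real j/real N)) / (\<zeta> - of_real r * cis (2*pi*real j/real N)))) / real N
      - h \<zeta>\<bar> \<le> \<delta>)"
proof -
  have "compact (h ` sphere 0 1)" using h by (intro compact_continuous_image) auto
  then obtain M where M: "M > 0" "\<And>u. cmod u = 1 \<Longrightarrow> \<bar>h u\<bar> \<le> M"
    using compact_imp_bounded bounded_pos by (metis dist_0_norm image_eqI mem_sphere real_norm_def)
  have "uniformly_continuous_on (sphere 0 1) h" using h by (intro compact_uniformly_continuous) auto
  then obtain d where d: "d > 0" "\<And>u v. cmod u = 1 \<Longrightarrow> cmod v = 1 \<Longrightarrow> cmod (u - v) < d \<Longrightarrow> \<bar>h u - h v\<bar> < \<delta> / 6"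
    using \<delta> unfolding uniformly_continuous_on_def
    by (metis dist_0_norm dist_norm mem_sphere real_norm_def zero_less_divide_iff zero_less_numeral)
  \<comment> \<open>This \<open>L\<close> gives a Korovkin majorant: beyond distance
    \<open>d\<close> the oscillation \<open>2 * M\<close> is at most \<open>L\<close> times the
    squared distance, so only the mean and the second moment of the kernel matter.\<close>
  define L where "L = 2 * M / d\<^sup>2"
  have L: "L > 0" using M d by (simp add: L_def)
  have hL: "\<bar>h u - h v\<bar> \<le> \<delta> / 6 + L * (cmod (u - v))\<^sup>2"
    if "cmod u = 1" "cmod v = 1" for u v
  proof (cases "cmod (u - v) < d")
    case True
    then show ?thesis using d(2)[OF that] L by (simp add: add_increasing2)
  next
    case False
    then have "d\<^sup>2 \<le> (cmod (u - v))\<^sup>2" using d by (intro power_mono) auto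
    then have "2 * M \<le> L * (cmod (u - v))\<^sup>2"
      using d M by (simp add: L_def field_simps)
    then show ?thesis using M(2)[OF that(1)] M(2)[OF that(2)] \<delta> by linarith
  qed
  \<comment> \<open>The final error has three parts of size \<open>\<delta> / 3\<close>: uniform
    continuity, the second moment \<open>8 * L * (1 - r)\<close>, and the sampling error
    \<open>M * (3 * r ^ N)\<close>. The first choice is \<open>r\<close>; \<open>N\<close> is then
    taken large depending on it.\<close>
  define r where "r = max (1/2) (1 - \<delta> / (24 * L))"
  have r: "0 < r" "r < 1" "8 * L * (1 - r) \<le> \<delta> / 3"
    using L \<delta> by (auto simp: r_def max_def field_simps)
  have "(\<lambda>N. r ^ N) \<longlonglongrightarrow> 0" using r by (intro LIMSEQ_realpow_zero) auto
  then have "\<forall>\<^sub>F N in sequentially. r ^ N < min (1/3) (\<delta> / (9 * M))"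
    using \<delta> M by (intro order_tendstoD) auto
  then obtain N1 where N1: "\<And>N. N \<ge> N1 \<Longrightarrow> r ^ N < min (1/3) (\<delta> / (9 * M))"
    unfolding eventually_sequentially by blast
  have main: "\<bar>(\<Sum>j<N. h (cis (2*pi*real j/real N)) *
        Re ((\<zeta> + of_real r * cis (2*pi*real j/real N)) / (\<zeta> - of_real r * cis (2*pi*real j/real N)))) / real N
      - h \<zeta>\<bar> \<le> \<delta>" if N: "N \<ge> Suc N1" and \<zeta>: "cmod \<zeta> = 1" for N \<zeta>
  proof -
    have N0: "N > 0" and rN: "r ^ N \<le> 1/3" "M * (3 * r ^ N) \<le> \<delta> / 3"
      using N N1[of N] M by (auto simp: field_simps)
    let ?z = "\<lambda>j. cis (2*pi*real j/real N)"
    define x where "x = of_real r * cnj \<zeta>"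
    have x: "cmod x = r" "cmod x < 1" using r \<zeta> by (auto simp: x_def norm_mult)
    define K where "K j = Re ((1 + x * ?z j) / (1 - x * ?z j))" for j
    have KK: "Re ((\<zeta> + of_real r * ?z j) / (\<zeta> - of_real r * ?z j)) = K j" for j
      unfolding herglotz_unit[OF \<zeta>] K_def x_def by (simp add: mult_ac)
    have xz: "cmod (x * ?z j) = r" for j by (simp add: norm_mult x)
    then have ne: "x * ?z j \<noteq> 1" for j using r by (metis norm_one less_irrefl)
    have K': "K j = (1 - r\<^sup>2) / (cmod (1 - x * ?z j))\<^sup>2" for j
      unfolding K_def Re_herglotz xz ..
    have r2: "0 \<le> 1 - r\<^sup>2" "1 - r\<^sup>2 \<le> 2 * (1 - r)"
      using r by (auto simp: power_le_one) (use zero_le_power2[of "1 - r"] in \<open>simp add: power2_eq_square algebra_simps\<close>)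
    have K0: "K j \<ge> 0" for j using r2 by (simp add: K')
    have "(\<Sum>j<N. K j) = Re (\<Sum>j<N. 2 * (1 / (1 - x * ?z j)) - 1)"
      unfolding Re_sum K_def using ne by (intro sum.cong refl arg_cong[where f=Re]) (auto simp: field_simps)
    also have "(\<Sum>j<N. 2 * (1 / (1 - x * ?z j)) - 1) = 2 * (of_nat N / (1 - x^N)) - of_nat N"
      unfolding sum_subtractf sum_distrib_left[symmetric] sum_inverse_one_minus_roots[OF N0 x(2)] by simp
    also have "\<dots> = ((1 + x^N) / (1 - x^N)) * of_nat N"
    proof -
      have "cmod (x ^ N) \<noteq> cmod 1" using rN by (simp add: norm_power x)
      then have "x^N \<noteq> 1" by metis
      then show ?thesis by (simp add: field_simps)
    qed
    finally have sK: "(\<Sum>j<N. K j) / real N = Re ((1 + x^N) / (1 - x^N))"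
      using N0 by (simp only: Re_mult_of_nat) simp
    \<comment> \<open>Sampling the Poisson kernel at \<open>N\<close> points leaves only the
      frequencies that are multiples of \<open>N\<close>, which have size \<open>r ^ N\<close> or
      less.\<close>
    have avg: "\<bar>(\<Sum>j<N. K j) / real N - 1\<bar> \<le> 3 * r ^ N"
    proof -
      have n: "cmod (x ^ N) = r ^ N" by (simp add: norm_power x)
      then have 2: "cmod (1 - x ^ N) \<ge> 2/3" using norm_triangle_ineq2[of 1 "x^N"] rN by simp
      then have ne: "1 - x ^ N \<noteq> 0" by auto
      have "(\<Sum>j<N. K j) / real N - 1 = Re (2 * x ^ N / (1 - x ^ N))"
        unfolding sK using ne by (simp add: field_simps flip: minus_complex.simps one_complex.simps(1))
      also have "\<bar>\<dots>\<bar> \<le> cmod (2 * x ^ N / (1 - x ^ N))" by (rule abs_Re_le_cmod)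
      also have "\<dots> = 2 * r ^ N / cmod (1 - x ^ N)" by (simp add: norm_divide norm_mult n)
      also have "\<dots> \<le> 2 * r ^ N / (2/3)" using 2 r by (intro divide_left_mono) auto
      finally show ?thesis by simp
    qed
    have avg2: "(\<Sum>j<N. K j) / real N \<le> 2" using avg rN by linarith
    \<comment> \<open>Moving from radius \<open>r\<close> to the circle costs \<open>1 - r\<close>,
      and \<open>(cmod (1 - x * ?z j))\<^sup>2 * K j\<close> is exactly
      \<open>1 - r\<^sup>2\<close>, so the peak of the kernel cancels.\<close>
    have sec: "(cmod (?z j - \<zeta>))\<^sup>2 * K j \<le> 4 * (1 - r) + 2 * (1 - r) * K j" for j
    proof -
      have "\<zeta> * cnj \<zeta> = 1" using \<zeta> by (metis complex_norm_square of_real_1 one_power2)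
      then have "cmod (?z j - \<zeta>) = cmod (1 - ?z j * cnj \<zeta>)"
        by (metis (no_types, opaque_lifting) \<zeta> complex_mod_cnj left_diff_distrib mult.right_neutral norm_minus_commute norm_mult)
      also have "\<dots> = cmod ((1 - x * ?z j) + of_real (r - 1) * (?z j * cnj \<zeta>))"
        by (simp add: x_def algebra_simps)
      also have "\<dots> \<le> cmod (1 - x * ?z j) + (1 - r)"
        using r \<zeta>
          by (intro order_trans[OF norm_triangle_ineq]) (simp add: norm_mult del: of_real_diff)
      finally have "(cmod (?z j - \<zeta>))\<^sup>2 \<le> (cmod (1 - x * ?z j) + (1 - r))\<^sup>2"
        by (intro power_mono) auto
      also have "\<dots> \<le> 2 * (cmod (1 - x * ?z j))\<^sup>2 + 2 * (1 - r)\<^sup>2"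
        using zero_le_power2[of "cmod (1 - x * ?z j) - (1 - r)"]
          by (simp add: power2_eq_square algebra_simps)
      also have "\<dots> \<le> 2 * (cmod (1 - x * ?z j))\<^sup>2 + 2 * (1 - r)"
        using r power_decreasing[of 1 2 "1 - r"] by simp
      finally have "(cmod (?z j - \<zeta>))\<^sup>2 * K j \<le> (2 * (cmod (1 - x * ?z j))\<^sup>2 + 2 * (1 - r)) * K j"
        using K0 by (rule mult_right_mono)
      also have "\<dots> = 2 * (1 - r\<^sup>2) + 2 * (1 - r) * K j"
        using ne[of j] by (simp add: K' field_simps)
      also have "\<dots> \<le> 4 * (1 - r) + 2 * (1 - r) * K j"
        using r2 by (intro add_right_mono) simp
      finally show ?thesis .
    qed
    have "(\<Sum>j<N. h (?z j) * K j) / real N - h \<zeta>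
       = (\<Sum>j<N. (h (?z j) - h \<zeta>) * K j) / real N + h \<zeta> * ((\<Sum>j<N. K j) / real N - 1)"
      using N0 by (simp add: left_diff_distrib sum_subtractf sum_distrib_left field_simps)
    also have "\<bar>\<dots>\<bar> \<le> (\<Sum>j<N. \<bar>h (?z j) - h \<zeta>\<bar> * K j) / real N + \<bar>h \<zeta>\<bar> * (3 * r ^ N)"
      using K0 avg by (intro order_trans[OF abs_triangle_ineq] add_mono)
        (auto simp: abs_mult intro!: divide_right_mono mult_left_mono order_trans[OF sum_abs] sum_mono)
    also have "\<dots> \<le> (\<Sum>j<N. \<delta>/6 * K j + L * (4 * (1 - r) + 2 * (1 - r) * K j)) / real N + M * (3 * r ^ N)"
    proof (intro add_mono divide_right_mono sum_mono)
      fix j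
      have "\<bar>h (?z j) - h \<zeta>\<bar> * K j \<le> (\<delta>/6 + L * (cmod (?z j - \<zeta>))\<^sup>2) * K j"
        using K0 hL \<zeta> by (intro mult_right_mono) auto
      also have "\<dots> = \<delta>/6 * K j + L * ((cmod (?z j - \<zeta>))\<^sup>2 * K j)"
        by (simp add: algebra_simps)
      also have "\<dots> \<le> \<delta>/6 * K j + L * (4 * (1 - r) + 2 * (1 - r) * K j)"
        using sec L by (intro add_left_mono mult_left_mono) auto
      finally show "\<bar>h (?z j) - h \<zeta>\<bar> * K j \<le> \<delta>/6 * K j + L * (4 * (1 - r) + 2 * (1 - r) * K j)" .
    qed (use r M \<zeta> in \<open>auto intro!: mult_right_mono\<close>)
    also have "(\<Sum>j<N. \<delta>/6 * K j + L * (4 * (1 - r) + 2 * (1 - r) * K j))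
      = (\<Sum>j<N. (\<delta>/6 + 2 * L * (1 - r)) * K j + 4 * L * (1 - r))"
      by (simp add: algebra_simps)
    also have "\<dots> / real N = (\<delta>/6 + 2 * L * (1 - r)) * ((\<Sum>j<N. K j) / real N) + 4 * L * (1 - r)"
      unfolding sum.distrib sum_distrib_left[symmetric] add_divide_distrib using N0 by simp
    also have "\<dots> \<le> (\<delta>/6 + 2 * L * (1 - r)) * 2 + 4 * L * (1 - r)"
      using avg2 \<delta> L r by (intro add_right_mono mult_left_mono) auto
    finally have "\<bar>(\<Sum>j<N. h (?z j) * K j) / real N - h \<zeta>\<bar>
        \<le> (\<delta>/6 + 2 * L * (1 - r)) * 2 + 4 * L * (1 - r) + M * (3 * r ^ N)"
      by (meson add_right_mono)
    also have "\<dots> = \<delta> / 3 + 8 * L * (1 - r) + M * (3 * r ^ N)" by (simp add: algebra_simps)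
    finally show ?thesis unfolding KK using r(3) rN(2) by linarith
  qed
  show ?thesis using main r by blast
qed

section \<open>Poisson integrals tested against squared moduli of polynomials\<close>

lemma set_integrable_scaleR_continuous:
  fixes k :: "real \<Rightarrow> 'b::euclidean_space"
  assumes g: "set_integrable lborel {a..b} g" and k: "continuous_on {a..b} k"
  shows "set_integrable lborel {a..b} (\<lambda>t. g t *\<^sub>R k t)"
proof -
  have "bounded (k ` {a..b})"
    using k by (intro compact_imp_bounded compact_continuous_image) auto
  then obtain M where M: "\<And>t. t \<in> {a..b} \<Longrightarrow> norm (k t) \<le> M"
    unfolding bounded_iff by blast
  have m: "(\<lambda>t. indicator {a..b} t *\<^sub>R k t) \<in> borel_measurable borel"
    using borel_measurable_continuous_on_indicator[OF _ k] by simp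
  have g': "integrable lborel (\<lambda>t. indicator {a..b} t * g t)"
    using g by (simp add: set_integrable_def)
  have eq: "(\<lambda>t. indicator {a..b} t *\<^sub>R (g t *\<^sub>R k t))
      = (\<lambda>t. (indicator {a..b} t * g t) *\<^sub>R (indicator {a..b} t *\<^sub>R k t))"
    by (auto simp: indicator_def)
  show ?thesis unfolding set_integrable_def eq
  proof (rule Bochner_Integration.integrable_bound[OF integrable_mult_right[OF g', of M]])
    show "(\<lambda>t. (indicator {a..b} t * g t) *\<^sub>R indicator {a..b} t *\<^sub>R k t) \<in> borel_measurable lborel"
      using borel_measurable_scaleR[OF borel_measurable_integrable[OF g'], of "\<lambda>t. indicator {a..b} t *\<^sub>R k t"] m
      by simp
    show "AE t in lborel. norm ((indicator {a..b} t * g t) *\<^sub>R indicator {a..b} t *\<^sub>R k t)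
        \<le> norm (M * (indicator {a..b} t * g t))"
    proof (rule AE_I2)
      fix t
      show "norm ((indicator {a..b} t * g t) *\<^sub>R indicator {a..b} t *\<^sub>R k t)
        \<le> norm (M * (indicator {a..b} t * g t))"
      proof (cases "t \<in> {a..b}")
        case True
        then have "norm (k t) \<le> \<bar>M\<bar>" using M by fastforce
        then show ?thesis using True by (simp add: abs_mult) (metis abs_ge_zero mult.commute mult_left_mono)
      qed simp
    qed
  qed
qed

lemma
  fixes f :: "'i \<Rightarrow> 'c \<Rightarrow> 'b::{banach, second_countable_topology}"
  assumes "\<And>i. i \<in> J \<Longrightarrow> set_integrable M A (f i)"
  shows set_integrable_sum: "set_integrable M A (\<lambda>x. \<Sum>i\<in>J. f i x)"
    and set_integral_sum: "(LINT x:A|M. \<Sum>i\<in>J. f i x) = (\<Sum>i\<in>J. LINT x:A|M. f i x)"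
  using assms unfolding set_integrable_def set_lebesgue_integral_def scaleR_sum_right by auto

lemma cis_ne_of_norm_less: "cmod z < 1 \<Longrightarrow> cis t - z \<noteq> 0"
  by (metis eq_iff_diff_eq_0 less_irrefl norm_cis)

text \<open>On the circle \<open>|p|^2\<close> is uniformly close to a combination of Poisson
  kernels at interior points with the nonnegative weights \<open>h (y j) / N\<close>. As
  \<open>N\<close> exceeds the degree, discrete Parseval shows that these weights sum exactly to the
  sum of squared coefficients, so the pointwise bound \<open>- B\<close> carries over. The remainder
  is at most \<open>e / (G + 1) * G\<close>, where \<open>G\<close> is the integral of
  \<open>|g|\<close>.\<close>

lemma poisson_bound_polynomial:
  assumes g: "set_integrable lborel {0..2*pi} g"
    and B: "\<And>z. cmod z < 1 \<Longrightarrow> - B \<le> (LINT t:{0..2*pi}|lborel. g t * Re ((cis t + z) / (cis t - z)))"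
  shows "- B * (\<Sum>k\<le>degree p. (cmod (coeff p k))\<^sup>2) \<le> (LINT t:{0..2*pi}|lborel. g t * (cmod (poly p (cis t)))\<^sup>2)"
proof (rule field_le_epsilon)
  fix e :: real assume e: "e > 0"
  let ?I = "{0..2*pi}"
  define G where "G = (LINT t:?I|lborel. \<bar>g t\<bar>)"
  have G: "G \<ge> 0" unfolding G_def set_lebesgue_integral_def by simp
  define h where "h u = (cmod (poly p u))\<^sup>2" for u
  have "continuous_on (sphere 0 1) h" unfolding h_def by (intro continuous_intros)
  moreover have "e / (G + 1) > 0" using e G by simp
  ultimately obtain r N0 where r: "0 < r" "r < 1" and ap: "\<And>N \<zeta>. N \<ge> N0 \<Longrightarrow> cmod \<zeta> = 1 \<Longrightarrow> 
     \<bar>(\<Sum>j<N. h (cis (2*pi*real j/real N)) *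
        Re ((\<zeta> + of_real r * cis (2*pi*real j/real N)) / (\<zeta> - of_real r * cis (2*pi*real j/real N)))) / real N
      - h \<zeta>\<bar> \<le> e / (G + 1)"
    using poisson_approx by meson
  define N where "N = max N0 (degree p + 1)"
  have N: "N \<ge> N0" "N > degree p" "N > 0" by (auto simp: N_def)
  define y where "y j = cis (2*pi*real j/real N)" for j
  define K where "K j t = Re ((cis t + of_real r * y j) / (cis t - of_real r * y j))" for j t
  have ry: "cmod (of_real r * y j) < 1" for j using r by (simp add: y_def norm_mult)
  have cK: "continuous_on UNIV (K j)" for j
    unfolding K_def using cis_ne_of_norm_less[OF ry] by (intro continuous_intros) auto
  have iK: "set_integrable lborel ?I (\<lambda>t. g t * K j t)" for j
    using set_integrable_scaleR_continuous[OF g continuous_on_subset[OF cK[of j]]] by simp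
  have ih: "set_integrable lborel ?I (\<lambda>t. g t * h (cis t))"
    unfolding h_def using set_integrable_scaleR_continuous[OF g, of "\<lambda>t. (cmod (poly p (cis t)))\<^sup>2"]
    by (simp add: continuous_intros)
  define c where "c t = (\<Sum>j<N. h (y j) * K j t) / real N" for t
  have ap': "\<bar>c t - h (cis t)\<bar> \<le> e / (G + 1)" for t
    using ap[OF N(1), of "cis t"] by (simp add: c_def K_def y_def)
  have gc: "g t * c t = (\<Sum>j<N. h (y j) / real N * (g t * K j t))" for t
    by (simp add: c_def sum_distrib_left sum_divide_distrib mult_ac)
  have ic: "set_integrable lborel ?I (\<lambda>t. g t * c t)"
    unfolding gc using iK by (intro set_integrable_sum set_integrable_mult_right) auto
  have "(\<Sum>k\<le>degree p. (cmod (coeff p k))\<^sup>2) = (\<Sum>k<N. (cmod (coeff p k))\<^sup>2)"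
    using N by (intro sum.mono_neutral_left) (auto simp: coeff_eq_0)
  also have "real N * \<dots> = (\<Sum>j<N. (cmod (\<Sum>k<N. coeff p k * y j ^ k))\<^sup>2)"
    using discrete_parseval[of 1 "coeff p" N] by (simp add: y_def)
  also have "\<dots> = (\<Sum>j<N. h (y j))"
  proof -
    have "(\<Sum>k<N. coeff p k * u ^ k) = poly p u" for u
      unfolding poly_altdef using N by (intro sum.mono_neutral_right) (auto simp: coeff_eq_0)
    then show ?thesis by (simp add: h_def)
  qed
  finally have S: "(\<Sum>k\<le>degree p. (cmod (coeff p k))\<^sup>2) = (\<Sum>j<N. h (y j)) / real N"
    using N(3) by (simp add: field_simps)
  have "- B * (\<Sum>k\<le>degree p. (cmod (coeff p k))\<^sup>2) = (\<Sum>j<N. h (y j) / real N * (- B))"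
    by (simp add: S sum_distrib_left sum_divide_distrib sum_negf mult_ac)
  also have "\<dots> \<le> (\<Sum>j<N. h (y j) / real N * (LINT t:?I|lborel. g t * K j t))"
    using B[OF ry] by (intro sum_mono mult_left_mono) (auto simp: K_def h_def)
  also have "\<dots> = (LINT t:?I|lborel. g t * c t)"
    unfolding gc using iK
    by (subst set_integral_sum) (auto intro!: set_integrable_mult_right)
  also have "\<dots> \<le> (LINT t:?I|lborel. g t * h (cis t) + e / (G + 1) * \<bar>g t\<bar>)"
  proof (rule set_integral_mono[OF ic])
    show "set_integrable lborel ?I (\<lambda>t. g t * h (cis t) + e / (G + 1) * \<bar>g t\<bar>)"
      using ih g by (intro set_integral_add(1) set_integrable_mult_right set_integrable_abs)
    fix t
    have "g t * (c t - h (cis t)) \<le> \<bar>g t\<bar> * \<bar>c t - h (cis t)\<bar>"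
      by (metis abs_ge_self abs_mult)
    also have "\<dots> \<le> \<bar>g t\<bar> * (e / (G + 1))" using ap' by (intro mult_left_mono) auto
    finally show "g t * c t \<le> g t * h (cis t) + e / (G + 1) * \<bar>g t\<bar>"
      by (simp add: algebra_simps)
  qed
  also have "\<dots> = (LINT t:?I|lborel. g t * h (cis t)) + e / (G + 1) * G"
    unfolding G_def set_integral_mult_right[symmetric]
    using ih g by (intro set_integral_add(2) set_integrable_mult_right set_integrable_abs)
  also have "e / (G + 1) * G \<le> e" using e G by (simp add: field_simps)
  finally show "- B * (\<Sum>k\<le>degree p. (cmod (coeff p k))\<^sup>2) \<le> (LINT t:?I|lborel. g t * (cmod (poly p (cis t)))\<^sup>2) + e"
    by (simp add: h_def)
qed

section \<open>Parseval's identity on the circle\<close>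

lemma set_integral_cis_mult:
  "(LINT t:{0..2*pi}|lborel. cis t ^ k * cnj (cis t) ^ l) = (if k = l then of_real (2*pi) else 0)"
proof -
  have c: "continuous_on {0..2*pi} (\<lambda>t. cis t ^ k * cnj (cis t) ^ l)" by (intro continuous_intros)
  have "set_integrable lborel {0..2*pi} (\<lambda>t. cis t ^ k * cnj (cis t) ^ l)"
    using c by (intro borel_integrable_atLeastAtMost') 
  then have "(LINT t:{0..2*pi}|lborel. cis t ^ k * cnj (cis t) ^ l) = integral {0..2*pi} (\<lambda>t. cis t ^ k * cnj (cis t) ^ l)"
    by (rule set_borel_integral_eq_integral)
  also have "\<dots> = integral {0..2*pi} (\<lambda>t. cis ((real k - real l) * t))"
    by (simp add: Complex.DeMoivre cis_cnj cis_mult algebra_simps flip: complex_cnj_power)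
  also have "\<dots> = (if k = l then of_real (2*pi) else 0)"
  proof (cases "k = l")
    case False
    define m where "m = real k - real l"
    have m: "m \<noteq> 0" using False by (simp add: m_def)
    have "((\<lambda>t. cis (m * t)) has_integral (cis (m * (2*pi)) / (\<i> * m) - cis (m * 0) / (\<i> * m))) {0..2*pi}"
    proof (rule fundamental_theorem_of_calculus)
      fix t
      have "((\<lambda>t. cis (m * t) / (\<i> * m)) has_vector_derivative (m * (\<i> * cis (m * t))) / (\<i> * m)) (at t within {0..2*pi})"
        unfolding cis_conv_exp of_real_mult
        by (rule has_vector_derivative_real_field)
           (use m in \<open>auto intro!: derivative_eq_intros simp: field_simps\<close>)
      then show "((\<lambda>t. cis (m * t) / (\<i> * m)) has_vector_derivative cis (m * t)) (at t within {0..2*pi})"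
        using m by simp
    qed simp
    moreover have "cis (m * (2*pi)) = 1"
    proof -
      have "m * (2*pi) = 2 * pi * of_int (int k - int l)" by (simp add: m_def)
      then show ?thesis by (simp only: cis_multiple_2pi Ints_of_int)
    qed
    ultimately show ?thesis using False by (simp add: m_def integral_unique)
  qed (simp add: scaleR_conv_of_real)
  finally show ?thesis .
qed

lemma parseval_circle:
  "(LINT t:{0..2*pi}|lborel. (cmod (poly p (cis t)))\<^sup>2) = 2 * pi * (\<Sum>k\<le>degree p. (cmod (coeff p k))\<^sup>2)"
proof -
  let ?I = "{0..2*pi}"
  let ?e = "\<lambda>k l t. cis t ^ k * cnj (cis t) ^ l"
  have i: "set_integrable lborel ?I (?e k l)" for k l
    by (intro borel_integrable_atLeastAtMost' continuous_intros)
  have "complex_of_real (LINT t:?I|lborel. (cmod (poly p (cis t)))\<^sup>2)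
    = (LINT t:?I|lborel. complex_of_real ((cmod (poly p (cis t)))\<^sup>2))"
    by (simp only: set_integral_complex_of_real)
  also have "\<dots> = (LINT t:?I|lborel. (\<Sum>k\<le>degree p. \<Sum>l\<le>degree p. coeff p k * cnj (coeff p l) * ?e k l t))"
    by (simp only: complex_norm_square poly_altdef cnj_sum complex_cnj_mult complex_cnj_power sum_product mult_ac)
  also have "\<dots> = (\<Sum>k\<le>degree p. \<Sum>l\<le>degree p. coeff p k * cnj (coeff p l) * (LINT t:?I|lborel. ?e k l t))"
    using i by (subst set_integral_sum, simp, intro set_integrable_sum set_integrable_mult_right, simp, simp,
        subst set_integral_sum) auto
  also have "\<dots> = (\<Sum>k\<le>degree p. \<Sum>l\<le>degree p. if k = l then 2 * pi * (coeff p k * cnj (coeff p k)) else 0)"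
    by (intro sum.cong refl) (auto simp: set_integral_cis_mult)
  also have "\<dots> = complex_of_real (2 * pi * (\<Sum>k\<le>degree p. (cmod (coeff p k))\<^sup>2))"
    by (simp add: sum_distrib_left complex_norm_square del: of_real_power)
  finally show ?thesis using of_real_eq_iff by blast
qed

section \<open>From the Szego function to the measure\<close>

lemma integrable_continuous_circle:
  fixes k :: "real \<Rightarrow> 'b::euclidean_space"
  assumes "finite_measure \<nu>" and sets: "sets \<nu> = sets (restrict_space borel {0..2*pi})"
    and k: "continuous_on UNIV k"
  shows "integrable \<nu> k"
proof -
  have sp: "space \<nu> = {0..2*pi}"
    using sets_eq_imp_space_eq[OF sets] by (simp add: space_restrict_space)
  have "bounded (k ` {0..2*pi})"
    by (intro compact_imp_bounded compact_continuous_image continuous_on_subset[OF k]) auto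
  then obtain M where "\<And>t. t \<in> {0..2*pi} \<Longrightarrow> norm (k t) \<le> M"
    unfolding bounded_iff by blast
  moreover have "k \<in> borel_measurable \<nu>"
    unfolding measurable_cong_sets[OF sets refl]
    using k by (intro measurable_restrict_space1 borel_measurable_continuous_onI)
  ultimately show ?thesis
    using assms(1) by (intro finite_measure.integrable_const_bound[where B = M]) (auto simp: sp)
qed

text \<open>The logarithm of the modulus of the Szego function is \<open>- 1 / (4 * pi)\<close>
  times the Poisson integral of the logarithm of the density. The extension is bounded on the closed
  disc by compactness, and an upper bound \<open>M\<close> there becomes the lower bound
  \<open>- 4 * pi * ln M\<close> here.\<close>

lemma szego_poisson_bound:
  assumes "szego_class \<nu>" "szego_function_extends \<nu>"
  shows "\<exists>B. \<forall>z. cmod z < 1 \<longrightarrow>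
    - B \<le> (LINT t:{0..2*pi}|lborel. ln (ac_density \<nu> t) * Re ((cis t + z) / (cis t - z)))"
proof -
  let ?g = "\<lambda>t. ln (ac_density \<nu> t)"
  have g: "set_integrable lborel {0..2*pi} ?g" using assms(1) by (simp add: szego_class_def)
  obtain R F where R: "R > 1" and F: "F holomorphic_on ball 0 R" 
    and FD: "\<And>z. z \<in> ball 0 1 \<Longrightarrow> F z = szego_function \<nu> z"
    using assms(2) unfolding szego_function_extends_def by blast
  have "continuous_on (cball 0 1) F"
    using R by (intro continuous_on_subset[OF holomorphic_on_imp_continuous_on[OF F]]) auto
  then have "bounded (F ` cball 0 1)" by (intro compact_imp_bounded compact_continuous_image) auto
  then obtain M where M: "M > 0" "\<And>z. z \<in> cball 0 1 \<Longrightarrow> cmod (F z) \<le> M"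
    unfolding bounded_pos by blast
  have "- (4 * pi * ln M) \<le> (LINT t:{0..2*pi}|lborel. ?g t * Re ((cis t + z) / (cis t - z)))"
    if z: "cmod z < 1" for z
  proof -
    let ?k = "\<lambda>t. (cis t + z) / (cis t - z)"
    define J where "J = (LINT t:{0..2*pi}|lborel. ?k t * of_real (?g t))"
    have "continuous_on {0..2*pi} ?k"
      using cis_ne_of_norm_less[OF z] by (intro continuous_intros) auto
    from set_integrable_scaleR_continuous[OF g this]
    have "set_integrable lborel {0..2*pi} (\<lambda>t. ?k t * of_real (?g t))"
      by (simp add: scaleR_conv_of_real mult.commute)
    then have "Re J = (LINT t:{0..2*pi}|lborel. Re (?k t * of_real (?g t)))"
      unfolding J_def set_lebesgue_integral_def set_integrable_def by (subst integral_Re[symmetric]) auto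
    moreover have "Re (u * of_real x) = x * Re u" for u x by simp
    ultimately have J: "Re J = (LINT t:{0..2*pi}|lborel. ?g t * Re (?k t))" by (simp only:)
    have "F z = exp (- (1 / (4 * of_real pi)) * J)"
      using FD z by (simp add: szego_function_def J_def)
    also have "- (1 / (4 * of_real pi)) * J = of_real (- 1 / (4 * pi)) * J" by simp
    finally have "cmod (F z) = exp (- Re J / (4 * pi))"
      by (simp only: norm_exp_eq_Re) (simp add: field_simps)
    then have "exp (- Re J / (4 * pi)) \<le> M" using M(2)[of z] z by simp
    then have "- Re J / (4 * pi) \<le> ln M" using M(1) by (simp add: ln_ge_iff)
    then have "- (4 * pi * ln M) \<le> Re J" by (simp add: field_simps)
    then show ?thesis by (simp add: J)
  qed
  then show ?thesis by blast
qed

text \<open>Dropping the singular part shows that the measure with density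
  \<open>ac_density \<nu>\<close> on the interval lies below \<open>\<nu>\<close>; finiteness of the
  integral against \<open>\<nu>\<close> then gives integrability.\<close>

lemma ac_density_integral_le:
  assumes fin: "finite_measure \<nu>" and sets: "sets \<nu> = sets (restrict_space borel {0..2*pi})"
    and h: "continuous_on UNIV h" "\<And>t. h t \<ge> (0::real)"
  shows "set_integrable lborel {0..2*pi} (\<lambda>t. ac_density \<nu> t * h t)"
    and "(LINT t:{0..2*pi}|lborel. ac_density \<nu> t * h t) \<le> (LINT t|\<nu>. h t)"
proof -
  let ?I = "{0..2*pi}"
  let ?w = "ac_density \<nu>"
  have w[measurable]: "?w \<in> borel_measurable borel" and w0: "\<And>x. 0 \<le> ?w x"
    using is_ac_density_ac_density[OF fin sets] by (auto simp: is_ac_density_def)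
  have le: "(\<integral>\<^sup>+x\<in>A. ennreal (?w x) \<partial>lborel) \<le> emeasure \<nu> A"
    if "A \<in> sets \<nu>" for A
    using is_ac_density_ac_density[OF fin sets] that unfolding is_ac_density_def
    by (metis le_iff_add)
  have sp: "space \<nu> = ?I"
    using sets_eq_imp_space_eq[OF sets] by (simp add: space_restrict_space)
  define L where "L = restrict_space lborel ?I"
  define \<mu> where "\<mu> = density L (\<lambda>x. ennreal (?w x))"
  have sL: "sets L = sets \<nu>" by (simp add: L_def sets sets_restrict_space)
  have wL: "(\<lambda>x. ennreal (?w x)) \<in> borel_measurable L"
    unfolding L_def by (intro measurable_restrict_space1) simp
  have s\<mu>: "sets \<mu> = sets \<nu>" by (simp add: \<mu>_def sL)
  have hm[measurable]: "h \<in> borel_measurable borel" using h(1) by (rule borel_measurable_continuous_onI)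
  have "\<mu> \<le> \<nu>"
  unfolding le_measure[OF s\<mu>]
  proof
    fix A
    assume "A \<in> sets \<mu>"
    then have A: "A \<in> sets \<nu>" by (simp add: s\<mu>)
    then have "A \<subseteq> ?I" using sets.sets_into_space sp by blast
    then have "emeasure \<mu> A = (\<integral>\<^sup>+x\<in>A. ennreal (?w x) \<partial>lborel)"
      unfolding \<mu>_def using A[folded sL] wL
      by (subst emeasure_density) (auto simp: L_def nn_integral_restrict_space indicator_def intro!: nn_integral_cong)
    then show "emeasure \<mu> A \<le> emeasure \<nu> A" using le[OF A] by simp
  qed
  then have "(\<integral>\<^sup>+x. ennreal (h x) \<partial>\<mu>) \<le> (\<integral>\<^sup>+x. ennreal (h x) \<partial>\<nu>)"
    by (intro nn_integral_mono_measure s\<mu>)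
  also have "(\<integral>\<^sup>+x. ennreal (h x) \<partial>\<nu>) = ennreal (LINT t|\<nu>. h t)"
    using integrable_continuous_circle[OF fin sets h(1)] h(2) by (intro nn_integral_eq_integral) auto
  also have "(\<integral>\<^sup>+x. ennreal (h x) \<partial>\<mu>) = (\<integral>\<^sup>+x. ennreal (?w x) * ennreal (h x) \<partial>L)"
    unfolding \<mu>_def
      using wL by (intro nn_integral_density) (auto simp: L_def intro!: measurable_restrict_space1)
  also have "\<dots> = (\<integral>\<^sup>+x. ennreal (indicator ?I x *\<^sub>R (?w x * h x)) \<partial>lborel)"
    unfolding L_def by (subst nn_integral_restrict_space)
      (auto simp: indicator_def w0 h(2) ennreal_mult intro!: nn_integral_cong)
  finally have *: "(\<integral>\<^sup>+x. ennreal (indicator ?I x *\<^sub>R (?w x * h x)) \<partial>lborel) \<le> ennreal (LINT t|\<nu>. h t)" .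
  show i: "set_integrable lborel ?I (\<lambda>t. ?w t * h t)"
    unfolding set_integrable_def
  proof (rule integrableI_nonneg)
    show "(\<integral>\<^sup>+x. ennreal (indicator ?I x *\<^sub>R (?w x * h x)) \<partial>lborel) < \<infinity>"
      using * by (simp add: order_le_less_trans)
  qed (auto simp: w0 h(2))
  have "ennreal (LINT t:?I|lborel. ?w t * h t) = (\<integral>\<^sup>+x. ennreal (indicator ?I x *\<^sub>R (?w x * h x)) \<partial>lborel)"
    unfolding set_lebesgue_integral_def
    by (rule nn_integral_eq_integral[symmetric]) (use i in \<open>auto simp: set_integrable_def w0 h(2)\<close>)
  then have "ennreal (LINT t:?I|lborel. ?w t * h t) \<le> ennreal (LINT t|\<nu>. h t)"
    using * by simp
  then show "(LINT t:?I|lborel. ?w t * h t) \<le> (LINT t|\<nu>. h t)"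
    by (subst (asm) ennreal_le_iff) (auto simp: h(2))
qed

text \<open>
  The bound on \<open>\<Pi>\<close> only controls Poisson integrals of \<open>g = log \<nu>'\<close>. The convexity inequality
  \<open>\<nu>' \<ge> e\<^bsup>-C\<^esup> (1 + C + g)\<close> reduces the claim to those and avoids radial limits of \<open>\<Pi>\<close>.
\<close>

lemma szego_lower_bound:
  assumes sz: "szego_class \<nu>" and ext: "szego_function_extends \<nu>"
  shows "\<exists>c>0. \<forall>p. c * (\<Sum>k\<le>degree p. (cmod (coeff p k))\<^sup>2) \<le> (LINT t|\<nu>. (cmod (poly p (cis t)))\<^sup>2)"
proof -
  let ?I = "{0..2*pi}"
  let ?w = "ac_density \<nu>"
  let ?g = "\<lambda>t. ln (?w t)"
  have fin: "finite_measure \<nu>" and sets: "sets \<nu> = sets (restrict_space borel ?I)"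
    and pos: "AE t in lborel. t \<in> ?I \<longrightarrow> 0 < ?w t" and g: "set_integrable lborel ?I ?g"
    using sz by (auto simp: szego_class_def)
  obtain B where B: "\<And>z. cmod z < 1 \<Longrightarrow> - B \<le> (LINT t:?I|lborel. ?g t * Re ((cis t + z) / (cis t - z)))"
    using szego_poisson_bound[OF sz ext] by blast
  \<comment> \<open>With this value \<open>(1 + C) * (2 * pi * S)\<close> outweighs the possible
    loss \<open>B * S\<close> by exactly \<open>2 * pi * S\<close>.\<close>
  define C where "C = B / (2 * pi)"
  have "exp (- C) * 2 * pi * (\<Sum>k\<le>degree p. (cmod (coeff p k))\<^sup>2) \<le> (LINT t|\<nu>. (cmod (poly p (cis t)))\<^sup>2)" for p
  proof -
    define S where "S = (\<Sum>k\<le>degree p. (cmod (coeff p k))\<^sup>2)"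
    define h where "h t = (cmod (poly p (cis t)))\<^sup>2" for t
    have ch: "continuous_on A h" for A unfolding h_def by (intro continuous_intros)
    have h0: "h t \<ge> 0" for t by (simp add: h_def)
    have ih: "set_integrable lborel ?I h" by (intro borel_integrable_atLeastAtMost' ch)
    have igh: "set_integrable lborel ?I (\<lambda>t. ?g t * h t)"
      using set_integrable_scaleR_continuous[OF g ch] by simp
    have "- B * S \<le> (LINT t:?I|lborel. ?g t * h t)"
      unfolding S_def h_def by (rule poisson_bound_polynomial[OF g B])
    moreover have "(LINT t:?I|lborel. h t) = 2 * pi * S"
      unfolding S_def h_def by (rule parseval_circle)
    moreover have "(1 + C) * (2 * pi * S) - B * S = 2 * pi * S" by (simp add: C_def field_simps)
    ultimately have "2 * pi * S \<le> (1 + C) * (LINT t:?I|lborel. h t) + (LINT t:?I|lborel. ?g t * h t)"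
      by simp
    then have "exp (- C) * (2 * pi * S) \<le> exp (- C) * ((1 + C) * (LINT t:?I|lborel. h t) + (LINT t:?I|lborel. ?g t * h t))"
      by (intro mult_left_mono) auto
    also have "\<dots> = (LINT t:?I|lborel. exp (- C) * ((1 + C) * h t + ?g t * h t))"
      unfolding set_integral_mult_right using ih igh
      by (subst set_integral_add(2)) (auto intro: set_integrable_mult_right)
    also have "\<dots> \<le> (LINT t:?I|lborel. ?w t * h t)"
      unfolding set_lebesgue_integral_def
    proof (rule integral_mono_AE)
      show "integrable lborel (\<lambda>t. indicator ?I t *\<^sub>R (exp (- C) * ((1 + C) * h t + ?g t * h t)))"
        using ih igh unfolding set_integrable_def[symmetric]
        by (intro set_integrable_mult_right set_integral_add(1))
      show "integrable lborel (\<lambda>t. indicator ?I t *\<^sub>R (?w t * h t))"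
        using ac_density_integral_le(1)[OF fin sets ch h0] by (simp add: set_integrable_def)
      show "AE t in lborel. indicator ?I t *\<^sub>R (exp (- C) * ((1 + C) * h t + ?g t * h t)) \<le> indicator ?I t *\<^sub>R (?w t * h t)"
        using pos
      proof eventually_elim
        case (elim t)
        show ?case
        proof (cases "t \<in> ?I")
          case True
          then have w: "?w t > 0" using elim by simp
          have "1 + (C + ?g t) \<le> exp (C + ?g t)" by (rule exp_ge_add_one_self)
          also have "\<dots> = exp C * ?w t" using w by (simp add: exp_add)
          finally have "exp (- C) * (1 + (C + ?g t)) \<le> exp (- C) * (exp C * ?w t)" by simp
          also have "\<dots> = ?w t" by (simp add: exp_minus)
          finally have "exp (- C) * (1 + (C + ?g t)) * h t \<le> ?w t * h t"
            using h0 by (rule mult_right_mono)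
          moreover have "exp (- C) * ((1 + C) * h t + ?g t * h t) = exp (- C) * (1 + (C + ?g t)) * h t"
            by (simp add: algebra_simps)
          ultimately show ?thesis using True by simp
        qed simp
      qed
    qed
    also have "\<dots> \<le> (LINT t|\<nu>. h t)" by (rule ac_density_integral_le(2)[OF fin sets ch h0])
    finally show ?thesis by (simp add: S_def h_def mult.assoc)
  qed
  then show ?thesis by (intro exI[of _ "exp (- C) * 2 * pi"]) auto
qed

subsection \<open>Orthogonality of the Lagrange basis\<close>

definition lagrange_interp :: "complex set \<Rightarrow> (complex \<Rightarrow> complex) \<Rightarrow> complex poly" where
  "lagrange_interp Z y = (\<Sum>a\<in>Z. smult (y a / (\<Prod>b\<in>Z-{a}. a - b)) (\<Prod>b\<in>Z-{a}. [:-b, 1:]))"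

lemma degree_prod_linear: "finite Z \<Longrightarrow> degree (\<Prod>b\<in>Z. [:-b, 1:]) = card Z"
  for Z :: "'a::idom set"
  by (subst degree_prod_eq_sum_degree) auto

lemma degree_lagrange_interp: "finite Z \<Longrightarrow> degree (lagrange_interp Z y) \<le> card Z - 1"
  unfolding lagrange_interp_def
  by (intro degree_sum_le) (auto simp: degree_prod_linear intro: order_trans[OF degree_smult_le])

lemma poly_lagrange_interp:
  assumes Z: "finite Z" and c: "c \<in> Z"
  shows "poly (lagrange_interp Z y) c = y c"
proof -
  have "poly (lagrange_interp Z y) c = (\<Sum>a\<in>Z. y a / (\<Prod>b\<in>Z-{a}. a - b) * (\<Prod>b\<in>Z-{a}. c - b))"
    by (simp add: lagrange_interp_def poly_sum poly_prod)
  also have "\<dots> = (\<Sum>a\<in>Z. if a = c then y c else 0)"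
    using Z c by (intro sum.cong) auto
  also have "\<dots> = y c" using Z c by simp
  finally show ?thesis .
qed

lemma lagrange_interp_unique:
  assumes Z: "finite Z" "Z \<noteq> {}" and p: "degree p < card Z"
  shows "lagrange_interp Z (poly p) = p"
proof (rule ccontr)
  let ?q = "lagrange_interp Z (poly p) - p"
  assume "lagrange_interp Z (poly p) \<noteq> p"
  then have q: "?q \<noteq> 0" by simp
  have "card Z \<le> card {x. poly ?q x = 0}"
    using Z poly_roots_finite[OF q] by (intro card_mono) (auto simp: poly_lagrange_interp)
  also have "\<dots> \<le> degree ?q" using q by (rule card_poly_roots_bound)
  also have "\<dots> < card Z"
    using Z p degree_lagrange_interp[OF Z(1), of "poly p"] card_gt_0_iff[of Z]
      by (intro degree_diff_less) linarith+
  finally show False by simp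
qed

definition circle_inner :: "real measure \<Rightarrow> complex poly \<Rightarrow> complex poly \<Rightarrow> complex" where
  "circle_inner \<nu> p q = (LINT t|\<nu>. poly p (cis t) * cnj (poly q (cis t)))"

locale circle_measure = finite_measure \<nu> for \<nu> :: "real measure" +
  assumes sets_circle: "sets \<nu> = sets (restrict_space borel {0..2*pi})"
begin

lemma integrable_poly: "integrable \<nu> (\<lambda>t. poly p (cis t) * cnj (poly q (cis t)))"
  by (intro integrable_continuous_circle[OF finite_measure_axioms sets_circle] continuous_intros)

lemma circle_inner_sum_left: "circle_inner \<nu> (\<Sum>i\<in>A. p i) q = (\<Sum>i\<in>A. circle_inner \<nu> (p i) q)"
  unfolding circle_inner_def poly_sum sum_distrib_right
  by (intro Bochner_Integration.integral_sum integrable_poly)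

lemma circle_inner_smult_left: "circle_inner \<nu> (smult c p) q = c * circle_inner \<nu> p q"
  by (simp add: circle_inner_def mult.assoc)

lemma circle_inner_cnj: "cnj (circle_inner \<nu> p q) = circle_inner \<nu> q p"
  unfolding circle_inner_def Bochner_Integration.integral_cnj[symmetric]
  by (simp only: complex_cnj_mult complex_cnj_cnj mult.commute)

lemma circle_inner_sum_right: "circle_inner \<nu> q (\<Sum>i\<in>A. p i) = (\<Sum>i\<in>A. circle_inner \<nu> q (p i))"
  by (subst (1 2) circle_inner_cnj[symmetric]) (simp add: circle_inner_sum_left)

lemma circle_inner_smult_right: "circle_inner \<nu> q (smult c p) = cnj c * circle_inner \<nu> q p"
  by (subst (1 2) circle_inner_cnj[symmetric]) (simp add: circle_inner_smult_left)

lemma circle_inner_self: "circle_inner \<nu> p p = of_real (LINT t|\<nu>. (cmod (poly p (cis t)))\<^sup>2)"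
  unfolding circle_inner_def complex_norm_square[symmetric] by (rule integral_complex_of_real)

lemma circle_inner_orthogonal_sum:
  assumes "finite A" and "\<And>a b. a \<in> A \<Longrightarrow> b \<in> A \<Longrightarrow> a \<noteq> b \<Longrightarrow> circle_inner \<nu> (l a) (l b) = 0"
  shows "(LINT t|\<nu>. (cmod (poly (\<Sum>a\<in>A. smult (y a) (l a)) (cis t)))\<^sup>2)
    = (\<Sum>a\<in>A. (cmod (y a))\<^sup>2 * (LINT t|\<nu>. (cmod (poly (l a) (cis t)))\<^sup>2))"
proof -
  have "circle_inner \<nu> (\<Sum>a\<in>A. smult (y a) (l a)) (\<Sum>b\<in>A. smult (y b) (l b))
    = (\<Sum>a\<in>A. \<Sum>b\<in>A. y a * cnj (y b) * circle_inner \<nu> (l a) (l b))"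
    unfolding circle_inner_sum_left circle_inner_smult_left
    unfolding circle_inner_sum_right circle_inner_smult_right
    by (simp add: sum_distrib_left mult_ac)
  also have "\<dots> = (\<Sum>a\<in>A. \<Sum>b\<in>A. if a = b then y a * cnj (y a) * circle_inner \<nu> (l a) (l a) else 0)"
    using assms(2) by (intro sum.cong refl) auto
  also have "\<dots> = (\<Sum>a\<in>A. y a * cnj (y a) * circle_inner \<nu> (l a) (l a))"
    using assms(1) by simp
  also have "\<dots> = of_real (\<Sum>a\<in>A. (cmod (y a))\<^sup>2 * (LINT t|\<nu>. (cmod (poly (l a) (cis t)))\<^sup>2))"
    by (simp only: circle_inner_self complex_norm_square[symmetric] of_real_mult of_real_sum)
  finally show ?thesis unfolding circle_inner_self of_real_eq_iff .
qed

text \<open>The two products are \<open>(z - b) * s\<close> and \<open>(z - a) * s\<close> with a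
  common factor \<open>s\<close>. On the circle
  \<open>cnj (z - a) = - inverse a * (z - a) * cnj z\<close>, so the first times the conjugate of
  the second is a constant times the node polynomial times \<open>cnj (z * s)\<close>. The
  polynomial \<open>z * s\<close> vanishes at 0 and has degree below \<open>card Z\<close>, which is
  the range covered by \<open>W\<close>.\<close>

lemma lagrange_basis_orthogonal:
  assumes Z: "finite Z" "\<And>a. a \<in> Z \<Longrightarrow> cmod a = 1"
    and W: "\<And>q. degree q < card Z \<Longrightarrow> coeff q 0 = 0 \<Longrightarrow> circle_inner \<nu> (\<Prod>b\<in>Z. [:-b, 1:]) q = 0"
    and ab: "a \<in> Z" "b \<in> Z" "a \<noteq> b"
  shows "circle_inner \<nu> (\<Prod>c\<in>Z-{a}. [:-c, 1:]) (\<Prod>c\<in>Z-{b}. [:-c, 1:]) = 0"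
proof -
  define s where "s = (\<Prod>c\<in>Z-{a,b}. [:-c, 1:])"
  have fin: "finite (Z - X)" for X using Z(1) by simp
  have D: "Z - {a} - {b} = Z - {a,b}" "Z - {b} - {a} = Z - {a,b}" by auto
  have a: "(\<Prod>c\<in>Z-{a}. [:-c, 1:]) = [:-b, 1:] * s"
    unfolding s_def D(1)[symmetric] using ab by (intro prod.remove fin) auto
  have b: "(\<Prod>c\<in>Z-{b}. [:-c, 1:]) = [:-a, 1:] * s"
    unfolding s_def D(2)[symmetric] using ab by (intro prod.remove fin) auto
  have w: "(\<Prod>c\<in>Z. [:-c, 1:]) = [:-a, 1:] * ([:-b, 1:] * s)"
    unfolding a[symmetric] using ab by (intro prod.remove Z)
  have card: "card (Z - {a,b}) = card Z - 2" "card Z \<ge> 2"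
    using ab Z(1) card_mono[of Z "{a,b}"] by (auto simp: card_Diff_subset)
  have "degree s = card Z - 2" unfolding s_def degree_prod_linear[OF fin] card ..
  then have "degree ([:0, 1:] * s) < card Z"
    using card(2) by (intro le_less_trans[OF degree_mult_le]) simp
  then have "circle_inner \<nu> (\<Prod>c\<in>Z. [:-c, 1:]) ([:0, 1:] * s) = 0"
    by (rule W) simp
  moreover have "poly ([:-b, 1:] * s) (cis t) * cnj (poly ([:-a, 1:] * s) (cis t))
      = - inverse a * (poly (\<Prod>c\<in>Z. [:-c, 1:]) (cis t) * cnj (poly ([:0, 1:] * s) (cis t)))" for t
  proof -
    have ne: "a \<noteq> 0" using Z(2)[OF ab(1)] by auto
    have "cis t * cnj (cis t) = 1" by (simp add: cis_cnj cis_mult)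
    moreover have "a * cnj a = 1" using Z(2)[OF ab(1)] by (metis complex_norm_square of_real_1 one_power2)
    then have "cnj a = inverse a" by (metis inverse_unique)
    ultimately have eq: "cnj (cis t) - cnj a = - inverse a * (cis t - a) * cnj (cis t)"
      using ne by (simp add: left_diff_distrib right_diff_distrib mult.assoc)
    have lin: "poly [:-c, 1:] u = u - c" "poly [:0, 1:] u = u" for c u :: complex by simp_all
    show ?thesis
      unfolding w poly_mult lin complex_cnj_mult complex_cnj_diff eq
        by (simp only: mult_ac mult_minus_left mult_minus_right)
  qed
  ultimately show ?thesis
    unfolding a b circle_inner_def by simp
qed

text \<open>By orthogonality the integral of \<open>|p|^2\<close> is a sum of \<open>|p a|^2\<close>
  with the squared norms of the basis as weights. Interpolating the constant 1 shows that these
  quadrature weights add up to the total mass, so the bound does not grow with the number of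
  nodes.\<close>

lemma lagrange_interp_bound:
  assumes Z: "finite Z" "Z \<noteq> {}" "\<And>a. a \<in> Z \<Longrightarrow> cmod a = 1"
    and W: "\<And>q. degree q < card Z \<Longrightarrow> coeff q 0 = 0 \<Longrightarrow> circle_inner \<nu> (\<Prod>b\<in>Z. [:-b, 1:]) q = 0"
    and p: "degree p < card Z" "\<And>a. a \<in> Z \<Longrightarrow> cmod (poly p a) \<le> \<eta>"
  shows "(LINT t|\<nu>. (cmod (poly p (cis t)))\<^sup>2) \<le> \<eta>\<^sup>2 * measure \<nu> (space \<nu>)"
proof -
  define l where "l a = smult (1 / (\<Prod>b\<in>Z-{a}. a - b)) (\<Prod>b\<in>Z-{a}. [:-b, 1:])" for a
  have L: "lagrange_interp Z y = (\<Sum>a\<in>Z. smult (y a) (l a))" for y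
    by (simp only: lagrange_interp_def l_def smult_smult times_divide_eq_right mult_1_right)
  have orth: "circle_inner \<nu> (l a) (l b) = 0" if "a \<in> Z" "b \<in> Z" "a \<noteq> b" for a b
    unfolding l_def circle_inner_smult_left circle_inner_smult_right
    by (simp only: lagrange_basis_orthogonal[OF Z(1,3) W that] mult_zero_right)
  have sum: "(LINT t|\<nu>. (cmod (poly (lagrange_interp Z y) (cis t)))\<^sup>2)
      = (\<Sum>a\<in>Z. (cmod (y a))\<^sup>2 * (LINT t|\<nu>. (cmod (poly (l a) (cis t)))\<^sup>2))" for y
    unfolding L using Z(1) orth by (rule circle_inner_orthogonal_sum)
  have "lagrange_interp Z (poly 1) = 1"
    using Z by (intro lagrange_interp_unique) (auto simp: card_gt_0_iff)
  then have 1: "(\<Sum>a\<in>Z. LINT t|\<nu>. (cmod (poly (l a) (cis t)))\<^sup>2) = measure \<nu> (space \<nu>)"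
    using sum[of "poly 1"] by simp
  have "(LINT t|\<nu>. (cmod (poly p (cis t)))\<^sup>2) = (\<Sum>a\<in>Z. (cmod (poly p a))\<^sup>2 * (LINT t|\<nu>. (cmod (poly (l a) (cis t)))\<^sup>2))"
    using sum[of "poly p"] lagrange_interp_unique[OF Z(1,2) p(1)] by simp
  also have "\<dots> \<le> (\<Sum>a\<in>Z. \<eta>\<^sup>2 * (LINT t|\<nu>. (cmod (poly (l a) (cis t)))\<^sup>2))"
    using p(2) by (intro sum_mono mult_right_mono power_mono) auto
  also have "\<dots> = \<eta>\<^sup>2 * measure \<nu> (space \<nu>)" by (simp add: 1 flip: sum_distrib_left)
  finally show ?thesis .
qed

text \<open>On the circle reversal turns the moment of index \<open>k\<close> into the conjugate of
  the moment of index \<open>n - k\<close>. Both summands are therefore orthogonal to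
  \<open>z ^ k\<close> when \<open>0 < k < n\<close>; at \<open>k = 0\<close> the reversed one would
  involve the moment of index \<open>n\<close>, hence the condition on
  \<open>coeff q 0\<close>.\<close>

lemma para_orthogonal_inner:
  assumes \<phi>: "monic_orthogonal_polys \<nu> \<phi>" and q: "degree q < n" "coeff q 0 = 0"
  shows "circle_inner \<nu> (para_orthogonal \<phi> \<tau> n) q = 0"
proof -
  have deg: "degree (\<phi> n) = n" using \<phi> by (simp add: monic_orthogonal_polys_def)
  have orth: "(LINT t|\<nu>. poly (\<phi> n) (cis t) * cnj (cis t ^ k)) = 0" if "k < n" for k
    using \<phi> that by (simp add: monic_orthogonal_polys_def Complex.DeMoivre cis_cnj)
  have m: "circle_inner \<nu> (para_orthogonal \<phi> \<tau> n) (monom 1 k) = 0" if k: "0 < k" "k < n" for k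
  proof -
    have star: "poly (star_poly (\<phi> n)) (cis t) * cnj (cis t ^ k) = cnj (poly (\<phi> n) (cis t) * cnj (cis t ^ (n - k)))" for t
    proof -
      have "cis t ^ n * cnj (cis t ^ k) = cis t ^ (n - k)"
      proof -
        have "cis t ^ n = cis t ^ (n - k) * cis t ^ k" using k by (simp flip: power_add)
        then show ?thesis by (simp add: mult.assoc cis_cnj cis_mult flip: power_mult_distrib)
      qed
      moreover have "1 / cnj (cis t) = cis t" by (simp add: cis_cnj flip: cis_inverse inverse_eq_divide)
      ultimately show ?thesis
        by (simp add: poly_star_poly[OF deg] mult.commute mult.left_commute)
    qed
    have s: "(LINT t|\<nu>. poly (star_poly (\<phi> n)) (cis t) * cnj (cis t ^ k)) = 0"
      unfolding star Bochner_Integration.integral_cnj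
        using orth[of "n - k"] k by (simp only: diff_less complex_cnj_zero)
    have "circle_inner \<nu> (para_orthogonal \<phi> \<tau> n) (monom 1 k)
      = (LINT t|\<nu>. poly (\<phi> n) (cis t) * cnj (poly (monom 1 k) (cis t)) + \<tau> * (poly (star_poly (\<phi> n)) (cis t) * cnj (poly (monom 1 k) (cis t))))"
      by (simp add: circle_inner_def para_orthogonal_def algebra_simps)
    also have "\<dots> = (LINT t|\<nu>. poly (\<phi> n) (cis t) * cnj (poly (monom 1 k) (cis t)))
      + \<tau> * (LINT t|\<nu>. poly (star_poly (\<phi> n)) (cis t) * cnj (poly (monom 1 k) (cis t)))"
      using integrable_poly by (subst Bochner_Integration.integral_add) auto
    also have "\<dots> = 0"
      unfolding poly_monom mult_1 s orth[OF k(2)] by simp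
    finally show ?thesis .
  qed
  have "circle_inner \<nu> (para_orthogonal \<phi> \<tau> n) q
      = (\<Sum>k\<le>degree q. cnj (coeff q k) * circle_inner \<nu> (para_orthogonal \<phi> \<tau> n) (monom 1 k))"
  proof -
    have "q = (\<Sum>k\<le>degree q. smult (coeff q k) (monom 1 k))"
      by (simp add: smult_monom poly_as_sum_of_monoms)
    then have "circle_inner \<nu> (para_orthogonal \<phi> \<tau> n) q
      = circle_inner \<nu> (para_orthogonal \<phi> \<tau> n) (\<Sum>k\<le>degree q. smult (coeff q k) (monom 1 k))"
      by simp
    then show ?thesis by (simp only: circle_inner_smult_right circle_inner_sum_right)
  qed
  also have "\<dots> = 0" 
  proof (intro sum.neutral ballI)
    fix k assume "k \<in> {..degree q}"
    then show "cnj (coeff q k) * circle_inner \<nu> (para_orthogonal \<phi> \<tau> n) (monom 1 k) = 0"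
      using q m[of k] by (cases "k = 0") auto
  qed
  finally show ?thesis .
qed

end

subsection \<open>Trigonometric polynomials\<close>

lemma trig_poly_add: "trig_poly m S \<Longrightarrow> trig_poly m T \<Longrightarrow> trig_poly m (\<lambda>t. S t + T t)"
proof -
  assume "trig_poly m S" "trig_poly m T"
  then obtain a b c d where
    "\<And>t. S t = a 0 + (\<Sum>k=1..m. a k * of_real (cos (real k * t)) + b k * of_real (sin (real k * t)))"
    "\<And>t. T t = c 0 + (\<Sum>k=1..m. c k * of_real (cos (real k * t)) + d k * of_real (sin (real k * t)))"
    unfolding trig_poly_def by blast
  then show ?thesis unfolding trig_poly_def
    by - (rule exI[of _ "\<lambda>k. a k + c k"], rule exI[of _ "\<lambda>k. b k + d k"], simp add: sum.distrib algebra_simps)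
qed

lemma trig_poly_zero: "trig_poly m (\<lambda>t. 0)"
  unfolding trig_poly_def by (intro exI[of _ "\<lambda>_. 0"]) simp

lemma trig_poly_sum: "(\<And>i. i \<in> A \<Longrightarrow> trig_poly m (T i)) \<Longrightarrow> trig_poly m (\<lambda>t. \<Sum>i\<in>A. T i t)"
  by (induction A rule: infinite_finite_induct) (auto intro: trig_poly_zero trig_poly_add)

lemma trig_poly_frequency:
  fixes \<alpha> \<beta> :: real
  assumes "j \<le> m"
  shows "trig_poly m (\<lambda>t. \<alpha> * cos (real j * t) + \<beta> * sin (real j * t))"
proof (cases "j = 0")
  case True
  then show ?thesis unfolding trig_poly_def
    by - (rule exI[of _ "\<lambda>k. if k = 0 then \<alpha> else 0"], rule exI[of _ "\<lambda>_. 0"], simp)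
next
  case False
  show ?thesis unfolding trig_poly_def
  proof (intro exI allI)
    fix t
    have "(\<Sum>k=1..m. (if k = j then \<alpha> else 0) * of_real (cos (real k * t)) + (if k = j then \<beta> else 0) * of_real (sin (real k * t)))
      = (\<Sum>k=1..m. if k = j then \<alpha> * cos (real j * t) + \<beta> * sin (real j * t) else 0)"
      by (intro sum.cong) auto
    also have "\<dots> = \<alpha> * cos (real j * t) + \<beta> * sin (real j * t)"
      using assms False by simp
    finally show "\<alpha> * cos (real j * t) + \<beta> * sin (real j * t) = (if 0 = j then \<alpha> else 0) +
      (\<Sum>k=1..m. (if k = j then \<alpha> else 0) * of_real (cos (real k * t)) + (if k = j then \<beta> else 0) * of_real (sin (real k * t)))"
      using False by simp
  qed
qed

text \<open>The shift moves the frequencies \<open>0, ..., degree p\<close> into the range from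
  \<open>- d\<close> to \<open>m\<close>. The real part then folds negative frequencies onto
  positive ones.\<close>

lemma trig_poly_Re_shifted_poly:
  assumes "degree p \<le> d + m" "d \<le> m"
  shows "trig_poly m (\<lambda>t. Re (cis (- (real d * t)) * poly p (cis t)))"
proof -
  have eq: "Re (cis (- (real d * t)) * poly p (cis t))
    = (\<Sum>k\<le>degree p. Re (coeff p k) * cos ((real k - real d) * t) + (- Im (coeff p k)) * sin ((real k - real d) * t))" for t
  proof -
    have "cis (- (real d * t)) * poly p (cis t) = (\<Sum>k\<le>degree p. coeff p k * cis ((real k - real d) * t))"
      unfolding poly_altdef sum_distrib_left Complex.DeMoivre
      by (intro sum.cong refl) (simp add: mult.left_commute cis_mult left_diff_distrib)
    then show ?thesis by simp
  qed
  show ?thesis unfolding eq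
  proof (rule trig_poly_sum)
    fix k assume k: "k \<in> {..degree p}"
    show "trig_poly m (\<lambda>t. Re (coeff p k) * cos ((real k - real d) * t) + (- Im (coeff p k)) * sin ((real k - real d) * t))"
    proof (cases "k \<ge> d")
      case True
      then have e: "real k - real d = real (k - d)" by simp
      show ?thesis unfolding e using k assms by (intro trig_poly_frequency) auto
    next
      case False
      then have e: "real k - real d = - real (d - k)" by simp
      show ?thesis
        unfolding e mult_minus_left cos_minus sin_minus mult_minus_right minus_minus
        using assms by (intro trig_poly_frequency) auto
    qed
  qed
qed

lemma trig_poly_scaleR:
  fixes v :: "'a::real_normed_field"
  assumes "trig_poly m T"
  shows "trig_poly m (\<lambda>t. T t *\<^sub>R v)"
proof -
  obtain a b where "\<And>t. T t = a 0 + (\<Sum>k=1..m. a k * of_real (cos (real k * t)) + b k * of_real (sin (real k * t)))"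
    using assms unfolding trig_poly_def by blast
  then show ?thesis unfolding trig_poly_def
    by - (rule exI[of _ "\<lambda>k. a k *\<^sub>R v"], rule exI[of _ "\<lambda>k. b k *\<^sub>R v"],
      simp add: scaleR_conv_of_real sum_distrib_left sum_distrib_right algebra_simps)
qed

subsection \<open>Interpolation\<close>

text \<open>The factor \<open>n\<close> is the number of coefficients in Cauchy-Schwarz; its square
  root is the growth of the Lebesgue constants.\<close>

lemma cmod_poly_le_coeffs:
  assumes "cmod u = 1" "degree p < n"
  shows "(cmod (poly p u))\<^sup>2 \<le> real n * (\<Sum>k\<le>degree p. (cmod (coeff p k))\<^sup>2)"
proof -
  have "cmod (poly p u) \<le> (\<Sum>k\<le>degree p. cmod (coeff p k) * 1)"
    unfolding poly_altdef using assms(1) by (intro sum_norm_le) (simp add: norm_mult norm_power)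
  then have "(cmod (poly p u))\<^sup>2 \<le> (\<Sum>k\<le>degree p. cmod (coeff p k) * 1)\<^sup>2"
    by (intro power_mono) auto
  also have "\<dots> \<le> (\<Sum>k\<le>degree p. (cmod (coeff p k))\<^sup>2) * (\<Sum>k\<le>degree p. 1\<^sup>2)"
    by (rule Cauchy_Schwarz_ineq_sum)
  also have "\<dots> \<le> (\<Sum>k\<le>degree p. (cmod (coeff p k))\<^sup>2) * real n"
    using assms(2) by (intro mult_left_mono sum_nonneg) auto
  finally show ?thesis by (simp add: mult.commute)
qed

lemma uniform_limit_sum:
  fixes f :: "'i \<Rightarrow> 'c \<Rightarrow> 'd \<Rightarrow> 'b::real_normed_vector"
  assumes "\<And>i. i \<in> A \<Longrightarrow> uniform_limit X (f i) (l i) F"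
  shows "uniform_limit X (\<lambda>n x. \<Sum>i\<in>A. f i n x) (\<lambda>x. \<Sum>i\<in>A. l i x) F"
  using assms by (induction A rule: infinite_finite_induct) (auto intro: uniform_limit_const uniform_limit_add)

text \<open>The coefficient of order \<open>n\<close> in
  \<open>para_orthogonal \<phi> \<tau> n\<close> is
  \<open>1 + \<tau> * cnj (coeff (\<phi> n) 0)\<close> and not 1, so the monic node polynomial
  equals the para-orthogonal one only up to this factor.\<close>

lemma poly_eq_smult_prod_roots:
  fixes p :: "complex poly"
  assumes Z: "finite Z" "Z \<noteq> {}" and p: "degree p \<le> card Z" "\<And>a. a \<in> Z \<Longrightarrow> poly p a = 0"
  shows "p = smult (coeff p (card Z)) (\<Prod>b\<in>Z. [:-b, 1:])"
proof -
  define W where "W = (\<Prod>b\<in>Z. [:-b, 1:])"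
  define q where "q = p - smult (coeff p (card Z)) W"
  have W: "degree W = card Z" "coeff W (card Z) = 1"
    using lead_coeff_prod[of "\<lambda>b. [:-b, 1:]" Z] degree_prod_linear[OF Z(1)] by (auto simp: W_def)
  have q0: "poly q a = 0" if "a \<in> Z" for a
    using p(2)[OF that] Z(1) that by (auto simp: q_def W_def poly_prod)
  have "degree q \<le> card Z" unfolding q_def
    using p(1) W by (intro degree_diff_le order_trans[OF degree_smult_le]) auto
  moreover have "coeff q (card Z) = 0" using W by (simp add: q_def)
  ultimately have "degree q < card Z"
    using Z by (metis card_gt_0_iff degree_0 leading_coeff_0_iff nat_less_le)
  from lagrange_interp_unique[OF Z this] have "q = 0"
    using q0 by (auto simp: lagrange_interp_def)
  then show ?thesis by (simp add: q_def W_def)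
qed

lemma degree_para_orthogonal_le:
  assumes "degree (\<phi> n) = n"
  shows "degree (para_orthogonal \<phi> \<tau> n) \<le> n"
proof -
  have "degree (map_poly cnj (\<phi> n)) = n" using assms by (simp add: degree_map_poly)
  then have "degree (star_poly (\<phi> n)) \<le> n"
    unfolding star_poly_def by (metis degree_reflect_poly_le)
  then show ?thesis unfolding para_orthogonal_def
    using assms by (intro degree_add_le order_trans[OF degree_smult_le]) auto
qed

section \<open>Interpolation at the zeros of para-orthogonal polynomials\<close>

context circle_measure
begin

lemma interp_error:
  assumes c: "c > 0" "\<And>p. c * (\<Sum>k\<le>degree p. (cmod (coeff p k))\<^sup>2) \<le> (LINT t|\<nu>. (cmod (poly p (cis t)))\<^sup>2)"
    and Z: "finite Z" "Z \<noteq> {}" "\<And>a. a \<in> Z \<Longrightarrow> cmod a = 1"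
    and W: "\<And>q. degree q < card Z \<Longrightarrow> coeff q 0 = 0 \<Longrightarrow> circle_inner \<nu> (\<Prod>b\<in>Z. [:-b, 1:]) q = 0"
    and p: "degree p < card Z" "\<And>a. a \<in> Z \<Longrightarrow> cmod (poly p a) \<le> \<eta>"
    and u: "cmod u = 1" and \<eta>: "\<eta> \<ge> 0"
  shows "cmod (poly p u) \<le> \<eta> * sqrt (real (card Z) * (measure \<nu> (space \<nu>) / c))"
proof -
  have "c * (\<Sum>k\<le>degree p. (cmod (coeff p k))\<^sup>2) \<le> \<eta>\<^sup>2 * measure \<nu> (space \<nu>)"
    using c(2) lagrange_interp_bound[OF Z W p] by (rule order_trans)
  then have "(\<Sum>k\<le>degree p. (cmod (coeff p k))\<^sup>2) \<le> \<eta>\<^sup>2 * (measure \<nu> (space \<nu>) / c)"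
    using c(1) by (simp add: field_simps)
  then have "(cmod (poly p u))\<^sup>2 \<le> real (card Z) * (\<eta>\<^sup>2 * (measure \<nu> (space \<nu>) / c))"
    by (intro order_trans[OF cmod_poly_le_coeffs[OF u p(1)]] mult_left_mono) auto
  then have "cmod (poly p u) \<le> sqrt (real (card Z) * (\<eta>\<^sup>2 * (measure \<nu> (space \<nu>) / c)))"
    by (rule real_le_rsqrt)
  also have "\<dots> = \<eta> * sqrt (real (card Z) * (measure \<nu> (space \<nu>) / c))"
    using \<eta> by (simp only: real_sqrt_mult real_sqrt_abs abs_of_nonneg mult_ac)
  finally show ?thesis .
qed

text \<open>With \<open>d = (n - 1) div 2\<close> the frequencies of the shifted interpolant run
  from \<open>- d\<close> to \<open>n - 1 - d\<close>, and both ends are bounded by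
  \<open>n div 2\<close>; for even \<open>n\<close> the range is lopsided and the real part
  symmetrises it. \<open>T\<close> is fixed before \<open>Q\<close> and \<open>\<eta>\<close>, so
  one interpolant profits from every approximation.\<close>

lemma trig_interpolation:
  fixes g :: "real \<Rightarrow> real"
  assumes c: "c > 0" "\<And>p. c * (\<Sum>k\<le>degree p. (cmod (coeff p k))\<^sup>2) \<le> (LINT t|\<nu>. (cmod (poly p (cis t)))\<^sup>2)"
    and \<phi>: "monic_orthogonal_polys \<nu> \<phi>" and n: "n \<ge> 1"
    and z: "bij_betw z {1..n} {x. poly (para_orthogonal \<phi> \<tau> n) x = 0}"
    and \<theta>: "\<And>j. j \<in> {1..n} \<Longrightarrow> \<theta> j \<in> {0..2*pi} \<and> cis (\<theta> j) = z j"
  defines "d \<equiv> (n - 1) div 2"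
  shows "\<exists>T. trig_poly (n div 2) T \<and> (\<forall>j\<in>{1..n}. T (\<theta> j) = g (\<theta> j)) \<and>
    (\<forall>Q \<eta>. degree Q \<le> 2 * d \<longrightarrow> (\<forall>t\<in>{0..2*pi}. cmod (poly Q (cis t) - cis (real d * t) * of_real (g t)) \<le> \<eta>) \<longrightarrow>
       (\<forall>t\<in>{0..2*pi}. \<bar>T t - g t\<bar> \<le> \<eta> + \<eta> * sqrt (real n * (measure \<nu> (space \<nu>) / c))))"
proof -
  define Z where "Z = z ` {1..n}"
  have inj: "inj_on z {1..n}" and Zr: "Z = {x. poly (para_orthogonal \<phi> \<tau> n) x = 0}"
    using z by (auto simp: bij_betw_def Z_def)
  have Z: "finite Z" "card Z = n" "Z \<noteq> {}" using inj n by (auto simp: Z_def card_image)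
  have Z1: "cmod a = 1" if "a \<in> Z" for a
    using that \<theta> unfolding Z_def by (metis (no_types, lifting) imageE norm_cis)
  have d: "2 * d < n" "n - 1 - d \<le> n div 2" "d \<le> n div 2" using n by (auto simp: d_def)
  have W: "circle_inner \<nu> (\<Prod>b\<in>Z. [:-b, 1:]) q = 0"
    if "degree q < card Z" "coeff q 0 = 0" for q
  proof -
    have "degree (\<phi> n) = n" using \<phi> by (simp add: monic_orthogonal_polys_def)
    then have "degree (para_orthogonal \<phi> \<tau> n) \<le> card Z"
      unfolding Z(2) by (rule degree_para_orthogonal_le)
    then have eq: "para_orthogonal \<phi> \<tau> n = smult (coeff (para_orthogonal \<phi> \<tau> n) n) (\<Prod>b\<in>Z. [:-b, 1:])"
      using poly_eq_smult_prod_roots[OF Z(1,3)] Zr unfolding Z(2) by blast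
    \<comment> \<open>The zero polynomial would vanish everywhere, whereas the root set is in
      bijection with a finite set.\<close>
    have "para_orthogonal \<phi> \<tau> n \<noteq> 0"
      using Z(1) Zr infinite_UNIV_char_0[where 'a = complex] by auto
    then have "coeff (para_orthogonal \<phi> \<tau> n) n \<noteq> 0" using eq by (metis smult_0_left)
    moreover have "coeff (para_orthogonal \<phi> \<tau> n) n * circle_inner \<nu> (\<Prod>b\<in>Z. [:-b, 1:]) q = 0"
      using para_orthogonal_inner[OF \<phi>, of q n \<tau>] that eq Z(2) by (metis circle_inner_smult_left)
    ultimately show ?thesis by simp
  qed
  \<comment> \<open>The node 1 has the two angles \<open>0\<close> and \<open>2 * pi\<close>;
    inverting \<open>z\<close> recovers the prescribed angle of each node.\<close>
  define y where "y a = a ^ d * of_real (g (\<theta> (the_inv_into {1..n} z a)))" for a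
  have y: "y (cis (\<theta> j)) = cis (real d * \<theta> j) * of_real (g (\<theta> j))"
    if "j \<in> {1..n}" for j
    using \<theta>[OF that] the_inv_into_f_f[OF inj that] by (simp add: y_def flip: Complex.DeMoivre)
  define P where "P = lagrange_interp Z y"
  have P: "degree P \<le> n - 1" "\<And>a. a \<in> Z \<Longrightarrow> poly P a = y a"
    using degree_lagrange_interp[OF Z(1), of y] poly_lagrange_interp[OF Z(1)] by (auto simp: P_def Z(2))
  define T where "T t = Re (cis (- (real d * t)) * poly P (cis t))" for t
  have in_Z: "cis (\<theta> j) \<in> Z"
    if "j \<in> {1..n}" for j using \<theta>[OF that] that by (auto simp: Z_def)
  have "trig_poly (n div 2) T"
    unfolding T_def using P(1) d by (intro trig_poly_Re_shifted_poly) auto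
  moreover have "T (\<theta> j) = g (\<theta> j)" if "j \<in> {1..n}" for j
    unfolding T_def P(2)[OF in_Z[OF that]] y[OF that] by (simp add: cis_mult flip: mult.assoc)
  moreover have "\<bar>T t - g t\<bar> \<le> \<eta> + \<eta> * sqrt (real n * (measure \<nu> (space \<nu>) / c))"
    if Q: "degree Q \<le> 2 * d" "\<forall>t\<in>{0..2*pi}. cmod (poly Q (cis t) - cis (real d * t) * of_real (g t)) \<le> \<eta>"
      and t: "t \<in> {0..2*pi}" for Q \<eta> t
  proof -
    have \<eta>: "\<eta> \<ge> 0" using Q(2) t by (meson norm_ge_zero order_trans)
    \<comment> \<open>At a node \<open>P\<close> takes the value of
      \<open>cis (d * t) * g t\<close>, so there \<open>P - Q\<close> is just the approximation
      error of \<open>Q\<close>.\<close>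
    have bd: "cmod (poly (P - Q) a) \<le> \<eta>" if aZ: "a \<in> Z" for a
    proof -
      obtain j where j: "j \<in> {1..n}" "a = z j" using aZ unfolding Z_def by blast
      have a: "a = cis (\<theta> j)" using \<theta>[OF j(1)] j(2) by simp
      have Pj: "poly P (cis (\<theta> j)) = cis (real d * \<theta> j) * of_real (g (\<theta> j))"
        using P(2)[OF aZ] unfolding a y[OF j(1)] .
      show ?thesis unfolding a poly_diff Pj
        by (subst norm_minus_commute) (use Q(2) \<theta>[OF j(1)] in blast)
    qed
    have dg: "degree (P - Q) < card Z"
      using P(1) Q(1) d n unfolding Z(2) by (intro degree_diff_less) auto
    have PQ: "cmod (poly (P - Q) (cis t)) \<le> \<eta> * sqrt (real n * (measure \<nu> (space \<nu>) / c))"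
      using interp_error[OF c Z(1,3) Z1 W dg bd norm_cis \<eta>] unfolding Z(2) .
    have "T t - g t = Re (cis (- (real d * t)) * (poly P (cis t) - cis (real d * t) * of_real (g t)))"
      by (simp add: T_def right_diff_distrib cis_mult flip: mult.assoc)
    also have "\<bar>\<dots>\<bar> \<le> cmod (cis (- (real d * t)) * (poly P (cis t) - cis (real d * t) * of_real (g t)))"
      by (rule abs_Re_le_cmod)
    also have "\<dots> = cmod ((poly Q (cis t) - cis (real d * t) * of_real (g t)) + poly (P - Q) (cis t))"
      by (simp add: norm_mult)
    also have "\<dots> \<le> \<eta> + \<eta> * sqrt (real n * (measure \<nu> (space \<nu>) / c))"
      using Q(2) t PQ by (intro order_trans[OF norm_triangle_ineq] add_mono) auto
    finally show ?thesis .
  qed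
  ultimately show ?thesis by (intro exI[of _ T]) blast
qed

lemma uniform_trig_interpolation:
  fixes g :: "real \<Rightarrow> real"
  assumes c: "c > 0" "\<And>p. c * (\<Sum>k\<le>degree p. (cmod (coeff p k))\<^sup>2) \<le> (LINT t|\<nu>. (cmod (poly p (cis t)))\<^sup>2)"
    and \<phi>: "monic_orthogonal_polys \<nu> \<phi>"
    and z: "\<And>n. n \<ge> 1 \<Longrightarrow> bij_betw (z n) {1..n} {x. poly (para_orthogonal \<phi> \<tau> n) x = 0}"
    and \<theta>: "\<And>n j. j \<in> {1..n} \<Longrightarrow> \<theta> n j \<in> {0..2*pi} \<and> cis (\<theta> n j) = z n j"
    and g: "\<And>\<epsilon>. \<epsilon> > 0 \<Longrightarrow> \<exists>A\<ge>0. \<forall>N>0. \<forall>s\<in>{0..2*pi}. \<forall>t\<in>{0..2*pi}. \<bar>g s - g t\<bar>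
      \<le> \<epsilon> / sqrt (real N) + (\<epsilon> * (real N)\<^sup>2 / sqrt (real N) + A) * (1 - cos (s - t))"
  shows "\<exists>T. (\<forall>n\<ge>1. trig_poly (n div 2) (T n) \<and> (\<forall>j\<in>{1..n}. T n (\<theta> n j) = g (\<theta> n j))) \<and>
    uniform_limit {0..2*pi} T g sequentially"
proof -
  define V where "V = measure \<nu> (space \<nu>) / c"
  have V: "V \<ge> 0" using c(1) by (simp add: V_def)
  have "\<exists>T. \<forall>n\<ge>1. trig_poly (n div 2) (T n) \<and> (\<forall>j\<in>{1..n}. T n (\<theta> n j) = g (\<theta> n j)) \<and>
    (\<forall>Q \<eta>. degree Q \<le> 2 * ((n - 1) div 2) \<longrightarrow> (\<forall>t\<in>{0..2*pi}. cmod (poly Q (cis t) - cis (real ((n - 1) div 2) * t) * of_real (g t)) \<le> \<eta>) \<longrightarrow>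
       (\<forall>t\<in>{0..2*pi}. \<bar>T n t - g t\<bar> \<le> \<eta> + \<eta> * sqrt (real n * V)))"
    unfolding V_def using trig_interpolation[OF c \<phi> _ z \<theta>] by (intro choice allI) blast
  then obtain T where T: "\<And>n. n \<ge> 1 \<Longrightarrow> trig_poly (n div 2) (T n)"
    "\<And>n j. n \<ge> 1 \<Longrightarrow> j \<in> {1..n} \<Longrightarrow> T n (\<theta> n j) = g (\<theta> n j)"
    and err: "\<And>n Q \<eta> t. n \<ge> 1 \<Longrightarrow> degree Q \<le> 2 * ((n - 1) div 2) \<Longrightarrow>
      \<forall>t\<in>{0..2*pi}. cmod (poly Q (cis t) - cis (real ((n - 1) div 2) * t) * of_real (g t)) \<le> \<eta> \<Longrightarrow>
      t \<in> {0..2*pi} \<Longrightarrow> \<bar>T n t - g t\<bar> \<le> \<eta> + \<eta> * sqrt (real n * V)"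
    by metis
  have "uniform_limit {0..2*pi} T g sequentially"
  proof (rule uniform_limitI)
    fix e :: real assume e: "e > 0"
    \<comment> \<open>Chosen so that \<open>1 + sqrt (n * V) \<le> sqrt N * \<kappa>\<close> when
      \<open>n \<le> 2 * N\<close>.\<close>
    define \<kappa> where "\<kappa> = 1 + sqrt (2 * V)"
    have \<kappa>: "\<kappa> \<ge> 1" using V by (simp add: \<kappa>_def)
    \<comment> \<open>The total will be \<open>(\<epsilon> + 18 * \<epsilon> + \<epsilon>) *
      \<kappa> = e / 2\<close>, the last \<open>\<epsilon>\<close> absorbing the term with
      \<open>A\<close>.\<close>
    define \<epsilon> where "\<epsilon> = e / (40 * \<kappa>)"
    have \<epsilon>: "\<epsilon> > 0" "\<epsilon> * \<kappa> = e / 40"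
      using e \<kappa> by (auto simp: \<epsilon>_def)
    obtain A where A: "A \<ge> 0" "\<And>N s t. N > 0 \<Longrightarrow> s \<in> {0..2*pi} \<Longrightarrow> t \<in> {0..2*pi} \<Longrightarrow> \<bar>g s - g t\<bar>
      \<le> \<epsilon> / sqrt (real N) + (\<epsilon> * (real N)\<^sup>2 / sqrt (real N) + A) * (1 - cos (s - t))"
      using g[OF \<epsilon>(1)] by blast
    \<comment> \<open>From here on \<open>36 * A \<le> \<epsilon> * n\<close>, so that
      \<open>18 * A \<le> \<epsilon> * N\<close> because \<open>n \<le> 2 * N\<close>.\<close>
    define n0 where "n0 = nat \<lceil>36 * A / \<epsilon>\<rceil> + 1"
    have "\<bar>T n t - g t\<bar> < e" if n: "n \<ge> n0" and t: "t \<in> {0..2*pi}" for n t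
    proof -
      \<comment> \<open>The offset 2 makes \<open>N - 2\<close> equal to the shift \<open>d\<close>,
        so the degree \<open>2 * (N - 2)\<close> of the Jackson polynomial fits the interpolation
        bound exactly.\<close>
      define N where "N = (n - 1) div 2 + 2"
      have N: "N \<ge> 2" "N - 2 = (n - 1) div 2" "n \<le> 2 * N" by (auto simp: N_def)
      have n1: "n \<ge> 1" using n by (simp add: n0_def)
      define \<eta> where "\<eta> = \<epsilon> / sqrt (real N) + 18 * (\<epsilon> * (real N)\<^sup>2 / sqrt (real N) + A) / (real N)\<^sup>2"
      obtain Q where Q: "degree Q \<le> 2 * (N - 2)"
        "\<forall>t\<in>{0..2*pi}. cmod (poly Q (cis t) - cis (real (N - 2) * t) * of_real (g t)) \<le> \<eta>"
        using jackson_approx[OF N(1) _ A(2), of N] \<epsilon>(1) A(1) N(1) unfolding \<eta>_def by auto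
      have "\<bar>T n t - g t\<bar> \<le> \<eta> + \<eta> * sqrt (real n * V)"
        using err[OF n1 Q[unfolded N(2)] t] .
      also have "\<dots> \<le> \<eta> * sqrt (real N) * \<kappa>"
      proof -
        have "\<eta> \<ge> 0" using \<epsilon>(1) A(1) by (simp add: \<eta>_def)
        moreover have "1 + sqrt (real n * V) \<le> sqrt (real N) * \<kappa>"
        proof -
          have "sqrt (real n * V) \<le> sqrt (real N * (2 * V))"
            using N(3) V mult_right_mono[of "real n" "2 * real N" V] by (simp add: mult_ac)
          moreover have "1 \<le> sqrt (real N)" using N(1) by simp
          ultimately show ?thesis
            unfolding \<kappa>_def distrib_left real_sqrt_mult[of "real N"] by linarith
        qed
        ultimately have "\<eta> * (1 + sqrt (real n * V)) \<le> \<eta> * (sqrt (real N) * \<kappa>)"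
          by (rule mult_left_mono[rotated])
        then show ?thesis by (simp add: distrib_left mult.assoc)
      qed
      also have "\<eta> * sqrt (real N) = 19 * \<epsilon> + 18 * A * sqrt (real N) / (real N)\<^sup>2"
        using N(1) by (simp add: \<eta>_def field_simps)
      also have "18 * A * sqrt (real N) / (real N)\<^sup>2 \<le> \<epsilon>"
      proof -
        have "36 * A / \<epsilon> \<le> real n" using n unfolding n0_def by linarith
        then have "36 * A \<le> \<epsilon> * real n" using \<epsilon>(1) by (simp add: field_simps)
        also have "\<dots> \<le> \<epsilon> * (2 * real N)"
          using \<epsilon>(1) N(3) by (intro mult_left_mono) auto
        finally have *: "18 * A \<le> \<epsilon> * real N" by simp
        have "sqrt (real N) \<le> real N" using N(1) by (intro real_le_lsqrt) (auto simp: power2_eq_square)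
        then have "18 * A * sqrt (real N) \<le> (\<epsilon> * real N) * real N"
          by (intro mult_mono[OF *]) (use \<epsilon>(1) in auto)
        then show ?thesis using N(1) by (simp add: field_simps power2_eq_square)
      qed
      then have "(19 * \<epsilon> + 18 * A * sqrt (real N) / (real N)\<^sup>2) * \<kappa> \<le> (20 * \<epsilon>) * \<kappa>"
        using \<kappa> by (intro mult_right_mono) auto
      also have "(20 * \<epsilon>) * \<kappa> = e / 2" using \<epsilon>(2) by simp
      finally show ?thesis using e by simp
    qed
    then show "\<forall>\<^sub>F n in sequentially. \<forall>t\<in>{0..2*pi}. dist (T n t) (g t) < e"
      unfolding eventually_sequentially dist_real_def by blast
  qed
  then show ?thesis using T by blast
qed

end

(* The sort of 'a has exactly the instances real and complex (up to isomorphism): f is real- or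
   complex-valued, and T n has coefficients in the same field. *)
theorem theorem7:
  fixes \<nu> :: "real measure"
    and \<phi> :: "nat \<Rightarrow> complex poly"
    and \<tau> :: complex
    and z :: "nat \<Rightarrow> nat \<Rightarrow> complex"
    and \<theta> :: "nat \<Rightarrow> nat \<Rightarrow> real"
    and f :: "real \<Rightarrow> 'a::{real_normed_field, euclidean_space}"
  assumes "szego_class \<nu>"
    and "szego_function_extends \<nu>"
    and "monic_orthogonal_polys \<nu> \<phi>"
    and "cmod \<tau> = 1"
    and "\<And>n. n \<ge> 1 \<Longrightarrow> bij_betw (z n) {1..n} {x. poly (para_orthogonal \<phi> \<tau> n) x = 0}"
    and "\<And>n j. j \<in> {1..n} \<Longrightarrow> \<theta> n j \<in> {0..2*pi} \<and> exp (\<i> * of_real (\<theta> n j)) = z n j"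
    and "continuous_on {0..2*pi} f"
    and "f 0 = f (2*pi)"
    and "modulus_of_continuity f \<in> o[at_right 0](\<lambda>\<delta>. \<delta> powr (1/2))"
  shows "\<exists>T :: nat \<Rightarrow> real \<Rightarrow> 'a.
           (\<forall>n\<ge>1. trig_poly (n div 2) (T n) \<and> (\<forall>j\<in>{1..n}. T n (\<theta> n j) = f (\<theta> n j))) \<and>
           uniform_limit {0..2*pi} T f sequentially"
proof -
  interpret circle_measure \<nu>
    using assms(1) by (simp add: szego_class_def circle_measure_def circle_measure_axioms_def)
  obtain c where c: "c > 0" "\<And>p. c * (\<Sum>k\<le>degree p. (cmod (coeff p k))\<^sup>2) \<le> (LINT t|\<nu>. (cmod (poly p (cis t)))\<^sup>2)"
    using szego_lower_bound[OF assms(1,2)] by blast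
  \<comment> \<open>The interpolants are real parts, so \<open>f\<close> is treated coordinate by
    coordinate; each coordinate inherits the estimate for the norm.\<close>
  have "\<exists>T. (\<forall>n\<ge>1. trig_poly (n div 2) (T n) \<and> (\<forall>j\<in>{1..n}. T n (\<theta> n j) = f (\<theta> n j) \<bullet> b)) \<and>
      uniform_limit {0..2*pi} T (\<lambda>t. f t \<bullet> b) sequentially" if b: "b \<in> Basis" for b
  proof (rule uniform_trig_interpolation[OF c assms(3,5)])
    fix n j :: nat assume "j \<in> {1..n}"
    then show "\<theta> n j \<in> {0..2*pi} \<and> cis (\<theta> n j) = z n j"
      using assms(6) by (simp add: cis_conv_exp)
  next
    fix \<epsilon> :: real assume "\<epsilon> > 0"
    from modulus_korovkin_bound[OF assms(7-9) this]
    obtain A where A: "A \<ge> 0" "\<forall>N>0. \<forall>s\<in>{0..2*pi}. \<forall>t\<in>{0..2*pi}. norm (f s - f t)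
        \<le> \<epsilon> / sqrt (real N) + (\<epsilon> * (real N)\<^sup>2 / sqrt (real N) + A) * (1 - cos (s - t))"
      by blast
    have "\<bar>f s \<bullet> b - f t \<bullet> b\<bar> \<le> norm (f s - f t)" for s t
      using Basis_le_norm[OF b, of "f s - f t"] by (simp add: inner_diff_left)
    then show "\<exists>A\<ge>0. \<forall>N>0. \<forall>s\<in>{0..2*pi}. \<forall>t\<in>{0..2*pi}. \<bar>f s \<bullet> b - f t \<bullet> b\<bar>
        \<le> \<epsilon> / sqrt (real N) + (\<epsilon> * (real N)\<^sup>2 / sqrt (real N) + A) * (1 - cos (s - t))"
      using A by (meson order_trans)
  qed
  then have "\<exists>T. \<forall>b\<in>Basis. (\<forall>n\<ge>1. trig_poly (n div 2) (T b n) \<and> (\<forall>j\<in>{1..n}. T b n (\<theta> n j) = f (\<theta> n j) \<bullet> b)) \<and>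
      uniform_limit {0..2*pi} (T b) (\<lambda>t. f t \<bullet> b) sequentially"
    by (intro bchoice) blast
  then obtain T where T: "\<And>b n. b \<in> Basis \<Longrightarrow> n \<ge> 1 \<Longrightarrow> trig_poly (n div 2) (T b n)"
      "\<And>b n j. b \<in> Basis \<Longrightarrow> n \<ge> 1 \<Longrightarrow> j \<in> {1..n} \<Longrightarrow> T b n (\<theta> n j) = f (\<theta> n j) \<bullet> b"
      "\<And>b. b \<in> Basis \<Longrightarrow> uniform_limit {0..2*pi} (T b) (\<lambda>t. f t \<bullet> b) sequentially"
    by blast
  show ?thesis
  proof (intro exI[of _ "\<lambda>n t. \<Sum>b\<in>Basis. T b n t *\<^sub>R b"] conjI allI impI ballI)
    fix n :: nat assume n: "n \<ge> 1"
    show "trig_poly (n div 2) (\<lambda>t. \<Sum>b\<in>Basis. T b n t *\<^sub>R b :: 'a)"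
      using T(1) n by (intro trig_poly_sum trig_poly_scaleR)
    fix j assume "j \<in> {1..n}"
    then have "(\<Sum>b\<in>Basis. T b n (\<theta> n j) *\<^sub>R b) = (\<Sum>b\<in>Basis. (f (\<theta> n j) \<bullet> b) *\<^sub>R b)"
      using T(2) n by (intro sum.cong) auto
    then show "(\<Sum>b\<in>Basis. T b n (\<theta> n j) *\<^sub>R b) = f (\<theta> n j)"
      by (simp add: euclidean_representation)
  next
    have "uniform_limit {0..2*pi} (\<lambda>n t. \<Sum>b\<in>Basis. T b n t *\<^sub>R b) (\<lambda>t. \<Sum>b\<in>Basis. (f t \<bullet> b) *\<^sub>R b) sequentially"
      by (intro uniform_limit_sum bounded_linear.uniform_limit[OF bounded_linear_scaleR_left] T(3))
    then show "uniform_limit {0..2*pi} (\<lambda>n t. \<Sum>b\<in>Basis. T b n t *\<^sub>R b) f sequentially"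
      by (simp add: euclidean_representation)
  qed
qed

end
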